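(* Let $G$ be a group, let $(\chi,b),(\eta,c)\in\widehat{G}\times Z(G)$ be pairs such that $\eta(b)=\chi(c)^{-1}$, and let $\beta\in\mathbb{K}$. Then there exists a $\tau_\eta$-derivation $\delta$ such that the iterated Ore extension $H=\mathbb{K}[G][x;\tau_\chi][y;\tau_\eta,\delta]$ is a Hopf algebra in which $x$ is $(1,b)$-primitive and $y$ is $(1,c)$-primitive, that is, $$\Delta(x)=x\otimes 1+b\otimes x,\qquad \Delta(y)=y\otimes 1+c\otimes y.$$ In particular, $H$ is generated as an algebra by the elements $g$ of $G$ and $x$ and $y$ such that $xg=\chi(g)gx$ and $yg=\eta(g)gy$ for all $g\in G$ and $$yx=q\,xy+\beta(1-cb),\qquad\text{where } q=\eta(b).$$ This Hopf algebra is denoted by $H(G,\chi,\eta,b,c,\beta)$.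
   Context: $\mathbb{K}$ is an algebraically closed field of characteristic zero. $Z(G)$ is the center of $G$ and $\widehat{G}$ is the group of homomorphisms $G\to\mathbb{K}^\times$. For an algebra $R$, an automorphism $\sigma$ and a $\sigma$-derivation $\delta$ of $R$, the Ore extension $R[x;\sigma,\delta]$ is the free left $R$-module with basis $\{x^i\mid i\ge 0\}$ subject to $xr=\sigma(r)x+\delta(r)$ for all $r\in R$; $R[x;\sigma]=R[x;\sigma,0]$. For a Hopf algebra $R$ and an algebra homomorphism $\chi:R\to\mathbb{K}$, the left winding automorphism $\tau_\chi$ of $R$ is $\tau_\chi(r)=\chi(r_1)r_2$, where $\Delta(r)=r_1\otimes r_2$ in Sweedler notation. Thus $\tau_\chi$ on $\mathbb{K}[G]$ is given by $\tau_\chi(g)=\chi(g)g$; the character $\eta$ is extended to $\mathbb{K}[G][x;\tau_\chi]$ by $\eta(x)=0$, so that $\tau_\eta(g)=\eta(g)g$ for $g\in G$ and $\tau_\eta(x)=\eta(b)x$. For group-like elements $g,h$ of a Hopf algebra, an element $u$ is $(g,h)$-primitive if $\Delta(u)=u\otimes g+h\otimes u$. In $H$ the elements of $G$ are group-like.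
   Formalization: The hypothesis "β = 0, or cb = 1, or χ(g)η(g) = 1 for all g in G" is added; without it the relations are inconsistent, e.g. G = Z² = ⟨s,t⟩, b = s, c = 1, η = 1, χ(s) = 1, χ(t) = 2, β = 1 forces t(1−s) = 0. *)

theory Defs
  imports "HOL-Library.Poly_Mapping" "HOL-Computational_Algebra.Polynomial"
begin

section \<open>Algebras over a field\<close>

text \<open>
  The carrier of an algebra is a whole type of class \<open>ab_group_add\<close>. The multiplication is a
  record field and not the class operation, because the multiplication of an Ore extension depends
  on the twisting data.
\<close>

record ('k, 'a) kalg =
  alg_scale :: "'k \<Rightarrow> 'a \<Rightarrow> 'a"
  alg_mult :: "'a \<Rightarrow> 'a \<Rightarrow> 'a"
  alg_one :: 'a

locale assoc_algebra = vector_space "alg_scale A"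
  for A :: "('k::field, 'a::ab_group_add) kalg" +
  assumes mult_assoc: "alg_mult A (alg_mult A u v) w = alg_mult A u (alg_mult A v w)"
    and one_left: "alg_mult A (alg_one A) u = u"
    and one_right: "alg_mult A u (alg_one A) = u"
    and add_left: "alg_mult A (u + v) w = alg_mult A u w + alg_mult A v w"
    and add_right: "alg_mult A u (v + w) = alg_mult A u v + alg_mult A u w"
    and scale_mult_left: "alg_mult A (alg_scale A k u) v = alg_scale A k (alg_mult A u v)"
    and scale_mult_right: "alg_mult A u (alg_scale A k v) = alg_scale A k (alg_mult A u v)"

inductive_set subalgebra_generated :: "('k, 'a::ab_group_add) kalg \<Rightarrow> 'a set \<Rightarrow> 'a set"
  for A :: "('k, 'a::ab_group_add) kalg" and S :: "'a set" where
  base: "u \<in> S \<Longrightarrow> u \<in> subalgebra_generated A S"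
| one: "alg_one A \<in> subalgebra_generated A S"
| scale: "u \<in> subalgebra_generated A S \<Longrightarrow> alg_scale A k u \<in> subalgebra_generated A S"
| add: "u \<in> subalgebra_generated A S \<Longrightarrow> v \<in> subalgebra_generated A S \<Longrightarrow>
    u + v \<in> subalgebra_generated A S"
| mult: "u \<in> subalgebra_generated A S \<Longrightarrow> v \<in> subalgebra_generated A S \<Longrightarrow>
    alg_mult A u v \<in> subalgebra_generated A S"

definition skew_derivation ::
  "('k::field, 'a::ab_group_add) kalg \<Rightarrow> ('a \<Rightarrow> 'a) \<Rightarrow> ('a \<Rightarrow> 'a) \<Rightarrow> bool" where
  "skew_derivation A \<sigma> \<delta> \<longleftrightarrow>
     Vector_Spaces.linear (alg_scale A) (alg_scale A) \<delta> \<and>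
     (\<forall>r s. \<delta> (alg_mult A r s) = alg_mult A (\<sigma> r) (\<delta> s) + alg_mult A (\<delta> r) s)"

text \<open>
  Coefficientwise action \<open>\<Sum>\<^sub>i a\<^sub>i e\<^sub>i \<mapsto> \<Sum>\<^sub>i (s c a\<^sub>i) e\<^sub>i\<close> on finitely supported families.
\<close>

definition coeff_scale :: "('c \<Rightarrow> 'a \<Rightarrow> 'a) \<Rightarrow> 'c \<Rightarrow> ('i \<Rightarrow>\<^sub>0 'a::zero) \<Rightarrow> ('i \<Rightarrow>\<^sub>0 'a)" where
  "coeff_scale s c p = Poly_Mapping.map (s c) p"

text \<open>
  The linear extension of a function \<open>f\<close> given on the basis elements \<open>e\<^sub>i\<close> of a free
  vector space, with values in a vector space with scalar multiplication \<open>s\<close>.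
\<close>

definition lin_ext :: "('k \<Rightarrow> 'b \<Rightarrow> 'b) \<Rightarrow> ('i \<Rightarrow> 'b) \<Rightarrow> ('i \<Rightarrow>\<^sub>0 'k::zero) \<Rightarrow> 'b::comm_monoid_add" where
  "lin_ext s f t = (\<Sum>i\<in>Poly_Mapping.keys t. s (Poly_Mapping.lookup t i) (f i))"

section \<open>Tensor products\<close>

text \<open>
  \<open>A \<otimes> A\<close> is the free vector space on \<open>A \<times> A\<close> modulo the bilinearity relations. Its elements
  are represented by formal sums of pairs, and \<open>tensor_eq\<close> is equality in the quotient; likewise
  \<open>tensor3_eq\<close> for \<open>A \<otimes> A \<otimes> A\<close>. A linear map into \<open>A \<otimes> A\<close> is a choice of
  representatives which is linear up to \<open>tensor_eq\<close>.
\<close>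

type_synonym ('k, 'a) tensor = "('a \<times> 'a) \<Rightarrow>\<^sub>0 'k"
type_synonym ('k, 'a) tensor3 = "('a \<times> 'a \<times> 'a) \<Rightarrow>\<^sub>0 'k"

abbreviation ptensor :: "'a \<Rightarrow> 'a \<Rightarrow> ('k::zero_neq_one, 'a) tensor" where
  "ptensor u v \<equiv> Poly_Mapping.single (u, v) 1"

abbreviation ptensor3 :: "'a \<Rightarrow> 'a \<Rightarrow> 'a \<Rightarrow> ('k::zero_neq_one, 'a) tensor3" where
  "ptensor3 u v w \<equiv> Poly_Mapping.single (u, v, w) 1"

abbreviation free_scale :: "'k::field \<Rightarrow> ('i \<Rightarrow>\<^sub>0 'k) \<Rightarrow> ('i \<Rightarrow>\<^sub>0 'k)" where
  "free_scale \<equiv> coeff_scale (*)"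

definition tensor_relations :: "('k::field, 'a::ab_group_add) kalg \<Rightarrow> ('k, 'a) tensor set" where
  "tensor_relations A =
     {ptensor (u + u') v - ptensor u v - ptensor u' v |u u' v. True} \<union>
     {ptensor u (v + v') - ptensor u v - ptensor u v' |u v v'. True} \<union>
     {ptensor (alg_scale A k u) v - free_scale k (ptensor u v) |k u v. True} \<union>
     {ptensor u (alg_scale A k v) - free_scale k (ptensor u v) |k u v. True}"

definition tensor3_relations :: "('k::field, 'a::ab_group_add) kalg \<Rightarrow> ('k, 'a) tensor3 set" where
  "tensor3_relations A =
     {ptensor3 (u + u') v w - ptensor3 u v w - ptensor3 u' v w |u u' v w. True} \<union>
     {ptensor3 u (v + v') w - ptensor3 u v w - ptensor3 u v' w |u v v' w. True} \<union>
     {ptensor3 u v (w + w') - ptensor3 u v w - ptensor3 u v w' |u v w w'. True} \<union>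
     {ptensor3 (alg_scale A k u) v w - free_scale k (ptensor3 u v w) |k u v w. True} \<union>
     {ptensor3 u (alg_scale A k v) w - free_scale k (ptensor3 u v w) |k u v w. True} \<union>
     {ptensor3 u v (alg_scale A k w) - free_scale k (ptensor3 u v w) |k u v w. True}"

definition tensor_eq ::
  "('k::field, 'a::ab_group_add) kalg \<Rightarrow> ('k, 'a) tensor \<Rightarrow> ('k, 'a) tensor \<Rightarrow> bool" where
  "tensor_eq A s t \<longleftrightarrow> s - t \<in> module.span free_scale (tensor_relations A)"

definition tensor3_eq ::
  "('k::field, 'a::ab_group_add) kalg \<Rightarrow> ('k, 'a) tensor3 \<Rightarrow> ('k, 'a) tensor3 \<Rightarrow> bool" where
  "tensor3_eq A s t \<longleftrightarrow> s - t \<in> module.span free_scale (tensor3_relations A)"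

definition tensor_mult ::
  "('k::field, 'a::ab_group_add) kalg \<Rightarrow> ('k, 'a) tensor \<Rightarrow> ('k, 'a) tensor \<Rightarrow> ('k, 'a) tensor"
where
  "tensor_mult A s t =
     lin_ext free_scale (\<lambda>(u, v).
       lin_ext free_scale (\<lambda>(u', v'). ptensor (alg_mult A u u') (alg_mult A v v')) t) s"

section \<open>Hopf algebras\<close>

locale hopf_algebra = assoc_algebra A
  for A :: "('k::field, 'a::ab_group_add) kalg" +
  fixes \<Delta> :: "'a \<Rightarrow> ('k, 'a) tensor" and \<epsilon> :: "'a \<Rightarrow> 'k" and S :: "'a \<Rightarrow> 'a"
  assumes comult_add: "tensor_eq A (\<Delta> (u + v)) (\<Delta> u + \<Delta> v)"
    and comult_scale: "tensor_eq A (\<Delta> (alg_scale A k u)) (free_scale k (\<Delta> u))"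
    and comult_one: "tensor_eq A (\<Delta> (alg_one A)) (ptensor (alg_one A) (alg_one A))"
    and comult_mult: "tensor_eq A (\<Delta> (alg_mult A u v)) (tensor_mult A (\<Delta> u) (\<Delta> v))"
    and coassoc:
      "tensor3_eq A
         (lin_ext free_scale (\<lambda>(v, w). lin_ext free_scale (\<lambda>(v1, v2). ptensor3 v1 v2 w) (\<Delta> v)) (\<Delta> u))
         (lin_ext free_scale (\<lambda>(v, w). lin_ext free_scale (\<lambda>(w1, w2). ptensor3 v w1 w2) (\<Delta> w)) (\<Delta> u))"
    and counit_linear: "Vector_Spaces.linear (alg_scale A) (*) \<epsilon>"
    and counit_one: "\<epsilon> (alg_one A) = 1"
    and counit_mult: "\<epsilon> (alg_mult A u v) = \<epsilon> u * \<epsilon> v"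
    and counit_left: "lin_ext (alg_scale A) (\<lambda>(v, w). alg_scale A (\<epsilon> v) w) (\<Delta> u) = u"
    and counit_right: "lin_ext (alg_scale A) (\<lambda>(v, w). alg_scale A (\<epsilon> w) v) (\<Delta> u) = u"
    and antipode_linear: "Vector_Spaces.linear (alg_scale A) (alg_scale A) S"
    and antipode_left:
      "lin_ext (alg_scale A) (\<lambda>(v, w). alg_mult A (S v) w) (\<Delta> u) = alg_scale A (\<epsilon> u) (alg_one A)"
    and antipode_right:
      "lin_ext (alg_scale A) (\<lambda>(v, w). alg_mult A v (S w)) (\<Delta> u) = alg_scale A (\<epsilon> u) (alg_one A)"

definition group_like ::
  "('k::field, 'a::ab_group_add) kalg \<Rightarrow> ('a \<Rightarrow> ('k, 'a) tensor) \<Rightarrow> 'a \<Rightarrow> bool" where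
  "group_like A \<Delta> g \<longleftrightarrow> g \<noteq> 0 \<and> tensor_eq A (\<Delta> g) (ptensor g g)"

definition skew_primitive ::
  "('k::field, 'a::ab_group_add) kalg \<Rightarrow> ('a \<Rightarrow> ('k, 'a) tensor) \<Rightarrow> 'a \<Rightarrow> 'a \<Rightarrow> 'a \<Rightarrow> bool" where
  "skew_primitive A \<Delta> g h u \<longleftrightarrow> tensor_eq A (\<Delta> u) (ptensor u g + ptensor h u)"

text \<open>\<open>\<tau>\<^sub>\<chi>(r) = \<chi>(r\<^sub>1) r\<^sub>2\<close> in Sweedler notation\<close>

definition left_winding ::
  "('k::field, 'a::ab_group_add) kalg \<Rightarrow> ('a \<Rightarrow> ('k, 'a) tensor) \<Rightarrow> ('a \<Rightarrow> 'k) \<Rightarrow> 'a \<Rightarrow> 'a" where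
  "left_winding A \<Delta> \<chi> r = lin_ext (alg_scale A) (\<lambda>(u, v). alg_scale A (\<chi> u) v) (\<Delta> r)"

section \<open>Ore extensions\<close>

text \<open>
  \<open>A[x;\<sigma>,\<delta>]\<close> as a left module is free on the powers \<open>x\<^sup>i\<close>: the family \<open>p\<close> stands for
  \<open>\<Sum>\<^sub>i p\<^sub>i x\<^sup>i\<close>, with coefficients on the left. Left multiplication by \<open>x\<close> is forced by
  \<open>x r = \<sigma>(r) x + \<delta>(r)\<close>; iterating it determines the whole multiplication.
\<close>

definition ore_var_mult :: "('a \<Rightarrow> 'a) \<Rightarrow> ('a \<Rightarrow> 'a) \<Rightarrow> (nat \<Rightarrow>\<^sub>0 'a) \<Rightarrow> (nat \<Rightarrow>\<^sub>0 'a::ab_group_add)" where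
  "ore_var_mult \<sigma> \<delta> p =
     (\<Sum>i\<in>Poly_Mapping.keys p.
        Poly_Mapping.single (Suc i) (\<sigma> (Poly_Mapping.lookup p i)) +
        Poly_Mapping.single i (\<delta> (Poly_Mapping.lookup p i)))"

definition ore_extension ::
  "('k, 'a::ab_group_add) kalg \<Rightarrow> ('a \<Rightarrow> 'a) \<Rightarrow> ('a \<Rightarrow> 'a) \<Rightarrow> ('k, nat \<Rightarrow>\<^sub>0 'a) kalg" where
  "ore_extension A \<sigma> \<delta> =
     \<lparr>alg_scale = coeff_scale (alg_scale A),
      alg_mult = (\<lambda>p q. \<Sum>i\<in>Poly_Mapping.keys p.
        coeff_scale (alg_mult A) (Poly_Mapping.lookup p i) ((ore_var_mult \<sigma> \<delta> ^^ i) q)),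
      alg_one = Poly_Mapping.single 0 (alg_one A)\<rparr>"

definition ore_const :: "'a \<Rightarrow> (nat \<Rightarrow>\<^sub>0 'a::zero)" where
  "ore_const r = Poly_Mapping.single 0 r"

definition ore_var :: "('k, 'a::zero) kalg \<Rightarrow> (nat \<Rightarrow>\<^sub>0 'a)" where
  "ore_var A = Poly_Mapping.single 1 (alg_one A)"

section \<open>Group algebras and their first Ore extension\<close>

text \<open>
  Groups are written additively, since the library's type class of (not necessarily commutative)
  groups is \<open>group_add\<close>: the product \<open>gh\<close> is \<open>g + h\<close> and the neutral element is \<open>0\<close>.
  The convolution product of \<open>'g \<Rightarrow>\<^sub>0 'k\<close> makes this type the group algebra \<open>K[G]\<close>.
\<close>

definition group_center :: "'g::group_add set" where
  "group_center = {z. \<forall>g. z + g = g + z}"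

definition is_character :: "('g::group_add \<Rightarrow> 'k::field) \<Rightarrow> bool" where
  "is_character \<chi> \<longleftrightarrow> (\<forall>g. \<chi> g \<noteq> 0) \<and> (\<forall>g h. \<chi> (g + h) = \<chi> g * \<chi> h)"

definition group_algebra :: "('k::field, 'g::group_add \<Rightarrow>\<^sub>0 'k) kalg" where
  "group_algebra = \<lparr>alg_scale = coeff_scale (*), alg_mult = (*), alg_one = 1\<rparr>"

definition group_elem :: "'g \<Rightarrow> ('g \<Rightarrow>\<^sub>0 'k::field)" where
  "group_elem g = Poly_Mapping.single g 1"

definition group_comult :: "('g \<Rightarrow>\<^sub>0 'k::field) \<Rightarrow> ('k, 'g \<Rightarrow>\<^sub>0 'k) tensor" where
  "group_comult = lin_ext free_scale (\<lambda>g. ptensor (group_elem g) (group_elem g))"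

definition char_ext :: "('g \<Rightarrow> 'k::field) \<Rightarrow> ('g \<Rightarrow>\<^sub>0 'k) \<Rightarrow> 'k" where
  "char_ext \<chi> = lin_ext (*) \<chi>"

text \<open>\<open>\<tau>\<^sub>\<chi>\<close> on \<open>K[G]\<close>\<close>

definition winding_group :: "('g::group_add \<Rightarrow> 'k::field) \<Rightarrow> ('g \<Rightarrow>\<^sub>0 'k) \<Rightarrow> ('g \<Rightarrow>\<^sub>0 'k)" where
  "winding_group \<chi> = left_winding group_algebra group_comult (char_ext \<chi>)"

definition first_ore :: "('g::group_add \<Rightarrow> 'k::field) \<Rightarrow> ('k, nat \<Rightarrow>\<^sub>0 'g \<Rightarrow>\<^sub>0 'k) kalg" where
  "first_ore \<chi> = ore_extension group_algebra (winding_group \<chi>) (\<lambda>_. 0)"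

text \<open>
  The comultiplication of \<open>K[G][x;\<tau>\<^sub>\<chi>]\<close> in which the elements of \<open>G\<close> are group-like and \<open>x\<close> is
  \<open>(1,b)\<close>-primitive; on the basis it is \<open>\<Delta>(g x\<^sup>i) = (g \<otimes> g) (x \<otimes> 1 + b \<otimes> x)\<^sup>i\<close>.
\<close>

definition first_ore_comult ::
  "('g::group_add \<Rightarrow> 'k::field) \<Rightarrow> 'g \<Rightarrow> (nat \<Rightarrow>\<^sub>0 'g \<Rightarrow>\<^sub>0 'k) \<Rightarrow> ('k, nat \<Rightarrow>\<^sub>0 'g \<Rightarrow>\<^sub>0 'k) tensor"
where
  "first_ore_comult \<chi> b p =
     (let x = ore_var group_algebra;
          elem = (\<lambda>g. ore_const (group_elem g));
          \<Delta>x = ptensor x (elem 0) + ptensor (elem b) x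
      in \<Sum>i\<in>Poly_Mapping.keys p.
           lin_ext free_scale
             (\<lambda>g. (tensor_mult (first_ore \<chi>) (ptensor (elem g) (elem g)))
                    ((tensor_mult (first_ore \<chi>) \<Delta>x ^^ i) (ptensor (elem 0) (elem 0))))
             (Poly_Mapping.lookup p i))"

text \<open>
  \<open>\<tau>\<^sub>\<eta>\<close> on \<open>K[G][x;\<tau>\<^sub>\<chi>]\<close>; here \<open>\<eta>\<close> is extended by \<open>\<eta>(x) = 0\<close>, so that it only sees
  the constant coefficient.
\<close>

definition winding_first_ore ::
  "('g::group_add \<Rightarrow> 'k::field) \<Rightarrow> 'g \<Rightarrow> ('g \<Rightarrow> 'k) \<Rightarrow> (nat \<Rightarrow>\<^sub>0 'g \<Rightarrow>\<^sub>0 'k) \<Rightarrow> (nat \<Rightarrow>\<^sub>0 'g \<Rightarrow>\<^sub>0 'k)" where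
  "winding_first_ore \<chi> b \<eta> =
     left_winding (first_ore \<chi>) (first_ore_comult \<chi> b) (\<lambda>p. char_ext \<eta> (Poly_Mapping.lookup p 0))"

definition second_ore ::
  "('g::group_add \<Rightarrow> 'k::field) \<Rightarrow> ('g \<Rightarrow> 'k) \<Rightarrow> 'g \<Rightarrow>
   ((nat \<Rightarrow>\<^sub>0 'g \<Rightarrow>\<^sub>0 'k) \<Rightarrow> (nat \<Rightarrow>\<^sub>0 'g \<Rightarrow>\<^sub>0 'k)) \<Rightarrow> ('k, nat \<Rightarrow>\<^sub>0 nat \<Rightarrow>\<^sub>0 'g \<Rightarrow>\<^sub>0 'k) kalg" where
  "second_ore \<chi> \<eta> b \<delta> = ore_extension (first_ore \<chi>) (winding_first_ore \<chi> b \<eta>) \<delta>"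

section \<open>Computation rules, and a necessary condition on the parameters\<close>

lemma coeff_scale_single: "s c 0 = 0 \<Longrightarrow> coeff_scale s c (Poly_Mapping.single i r) = Poly_Mapping.single i (s c r)"
  by (simp add: coeff_scale_def map_single)

lemma lookup_coeff_scale: "s c 0 = 0 \<Longrightarrow> Poly_Mapping.lookup (coeff_scale s c p) i = s c (Poly_Mapping.lookup p i)"
  by (simp add: coeff_scale_def map.rep_eq "when_def")

lemma coeff_scale_zero [simp]: "coeff_scale s c 0 = 0"
  by (rule poly_mapping_eqI) (simp add: coeff_scale_def map.rep_eq)

lemma single_eq_zero_iff: "Poly_Mapping.single i r = 0 \<longleftrightarrow> r = 0"
  by (metis lookup_single_eq lookup_zero single_zero)

lemma ore_mult_single0: 
  assumes "alg_mult A r 0 = 0" "alg_mult A 0 s = 0"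
  shows "alg_mult (ore_extension A \<sigma> \<delta>) (Poly_Mapping.single 0 r) (Poly_Mapping.single 0 s) = Poly_Mapping.single 0 (alg_mult A r s)"
  using assms by (cases "r = 0") (simp_all add: ore_extension_def coeff_scale_single)

lemma ore_var_mult_single: "\<sigma> 0 = 0 \<Longrightarrow> \<delta> 0 = 0 \<Longrightarrow>
  ore_var_mult \<sigma> \<delta> (Poly_Mapping.single i r) = Poly_Mapping.single (Suc i) (\<sigma> r) + Poly_Mapping.single i (\<delta> r)"
  by (cases "r = 0") (simp_all add: ore_var_mult_def)

lemma ore_var_commutes:
  assumes "\<sigma> 0 = 0" "\<delta> 0 = 0" "\<And>r. alg_mult A r 0 = 0"  "\<And>r. alg_mult A (alg_one A) r = r" "alg_one A \<noteq> 0"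
  shows "alg_mult (ore_extension A \<sigma> \<delta>) (ore_var A) (ore_const r) = Poly_Mapping.single 1 (\<sigma> r) + ore_const (\<delta> r)"
  using assms 
  apply (simp add: ore_extension_def ore_var_def ore_const_def ore_var_mult_single)
  by (rule poly_mapping_eqI) (simp add: lookup_coeff_scale)

lemma lin_ext_single: "s 0 (f i) = 0 \<Longrightarrow> lin_ext s f (Poly_Mapping.single i k) = s k (f i)"
  by (cases "k = 0") (simp_all add: lin_ext_def)

lemma lin_ext_add:
  assumes "\<And>a b u. s (a + b) u = s a u + s b u"
    and z: "\<And>u. s 0 u = 0"
  shows "lin_ext s f (p + q :: 'i \<Rightarrow>\<^sub>0 'k::comm_monoid_add) = lin_ext s f p + lin_ext s f q"
proof -
  let ?K = "Poly_Mapping.keys p \<union> Poly_Mapping.keys q"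
  have ext: "lin_ext s f t = (\<Sum>i\<in>?K. s (Poly_Mapping.lookup t i) (f i))" if "Poly_Mapping.keys t \<subseteq> ?K" for t
    unfolding lin_ext_def using that by (intro sum.mono_neutral_left) (auto simp: in_keys_iff z)
  show ?thesis
    using Poly_Mapping.keys_add[of p q]
    by (simp add: ext lookup_add assms sum.distrib)
qed

lemma winding_group_single:
  "winding_group \<chi> (Poly_Mapping.single g k) = Poly_Mapping.single g (k * \<chi> g)"
  by (simp add: winding_group_def left_winding_def group_comult_def lin_ext_single coeff_scale_single
      lookup_coeff_scale group_elem_def group_algebra_def char_ext_def)

lemma winding_first_ore_var:
  assumes "is_character \<chi>" "is_character \<eta>"
  shows "winding_first_ore \<chi> b \<eta> (ore_var group_algebra) = coeff_scale (coeff_scale (*)) (\<eta> b) (ore_var group_algebra)"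
proof -
  have c0: "\<chi> 0 = 1" "\<eta> 0 = 1" using assms unfolding is_character_def
    by (metis add_0 mult_cancel_right1)+
  have fs: "free_scale (a+b) u = free_scale a u + free_scale b u" for a b and u :: "'i \<Rightarrow>\<^sub>0 'b"
    by (rule poly_mapping_eqI) (simp add: lookup_coeff_scale lookup_add distrib_right)
  have f0: "free_scale 0 u = 0" for u :: "'i \<Rightarrow>\<^sub>0 'b"
    by (rule poly_mapping_eqI) (simp add: lookup_coeff_scale)
  have gs: "alg_scale (first_ore \<chi>) (a+b) u = alg_scale (first_ore \<chi>) a u + alg_scale (first_ore \<chi>) b u"
    "alg_scale (first_ore \<chi>) 0 u = 0" for a b u
    by (auto intro!: poly_mapping_eqI simp: first_ore_def ore_extension_def group_algebra_def lookup_coeff_scale lookup_add distrib_right lookup_coeff_scale[where s="coeff_scale _"])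
  have w1: "winding_group \<chi> 1 = 1"
    using winding_group_single[of \<chi> 0 1] c0 by simp
  have f1: "free_scale 1 u = u" for u :: "'i \<Rightarrow>\<^sub>0 'b"
    by (rule poly_mapping_eqI) (simp add: lookup_coeff_scale)
  have w0: "winding_group \<chi> 0 = 0"
    using winding_group_single[of \<chi> 0 0] c0 by simp
  let ?A = "first_ore \<chi>" and ?x = "ore_var group_algebra :: nat \<Rightarrow>\<^sub>0 'a \<Rightarrow>\<^sub>0 'b"
  let ?e = "\<lambda>g. ore_const (group_elem g) :: nat \<Rightarrow>\<^sub>0 'a \<Rightarrow>\<^sub>0 'b"
  have tm: "tensor_mult ?A (ptensor u v) (ptensor u' v') = ptensor (alg_mult ?A u u') (alg_mult ?A v v')" for u v u' v'
    by (simp add: tensor_mult_def lin_ext_single f0 f1)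
  have ta: "tensor_mult ?A (s + t) r = tensor_mult ?A s r + tensor_mult ?A t r" for s t r
    by (simp add: tensor_mult_def lin_ext_add[OF fs f0])
  have ta2: "tensor_mult ?A (ptensor u v) (s+t) = tensor_mult ?A (ptensor u v) s + tensor_mult ?A (ptensor u v) t" for u v s t
    by (simp add: tensor_mult_def lin_ext_single f0 f1 lin_ext_add[OF fs f0])
  have m1: "alg_mult ?A (?e 0) u = u" for u
    by (rule poly_mapping_eqI) (simp add: first_ore_def ore_extension_def group_algebra_def ore_const_def group_elem_def lookup_coeff_scale)
  have mx: "alg_mult ?A ?x (?e 0) = ?x"
    unfolding first_ore_def
    by (subst ore_var_commutes) (simp_all add: w0 group_algebra_def group_elem_def w1 ore_var_def, simp_all add: ore_const_def)
  have mb: "alg_mult ?A (?e b) (?e 0) = ?e b"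
    unfolding first_ore_def ore_const_def
    by (subst ore_mult_single0) (simp_all add: group_algebra_def group_elem_def)
  have k: "Poly_Mapping.keys ?x = {1}" "Poly_Mapping.lookup ?x 1 = Poly_Mapping.single 0 1"
    by (simp_all add: ore_var_def group_algebra_def)
  have d: "first_ore_comult \<chi> b ?x = ptensor ?x (?e 0) + ptensor (?e b) ?x"
    unfolding first_ore_comult_def Let_def k(1)
    using k(2) by (simp add: lin_ext_single f0 f1 ta ta2 tm m1 mx mb del: single_one)
  have s1: "alg_scale ?A 1 u = u" for u
    by (auto intro!: poly_mapping_eqI simp: first_ore_def ore_extension_def group_algebra_def lookup_coeff_scale lookup_coeff_scale[where s="coeff_scale _"])
  have l0: "char_ext \<eta> (Poly_Mapping.lookup ?x 0) = 0"
    by (simp add: ore_var_def char_ext_def lin_ext_def lookup_single)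
  have lb: "char_ext \<eta> (Poly_Mapping.lookup (?e b) 0) = \<eta> b"
    by (simp add: ore_const_def group_elem_def char_ext_def lin_ext_single)
  show ?thesis
    unfolding winding_first_ore_def left_winding_def d
    by (simp add: lin_ext_add[OF gs] lin_ext_single gs s1 l0 lb)
       (simp add: first_ore_def ore_extension_def group_algebra_def)
qed


lemma ore_mult_zero: assumes "\<And>r. alg_mult A r 0 = 0" "\<sigma> 0 = 0" "\<delta> 0 = 0"
  shows "alg_mult (ore_extension A \<sigma> \<delta>) p 0 = 0" "alg_mult (ore_extension A \<sigma> \<delta>) 0 p = 0"
proof -
  have "(ore_var_mult \<sigma> \<delta> ^^ i) 0 = 0" for i
    by (induction i) (simp_all add: ore_var_mult_def assms)
  then show "alg_mult (ore_extension A \<sigma> \<delta>) p 0 = 0" by (simp add: ore_extension_def)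
  show "alg_mult (ore_extension A \<sigma> \<delta>) 0 p = 0" by (simp add: ore_extension_def)
qed

text \<open>
  An associative algebra on the left module \<open>K[G][x][y]\<close> satisfying the three commutation rules of
  \<open>H(G,\<chi>,\<eta>,b,c,\<beta>)\<close> can only exist if \<open>\<beta> (1 - cb) = 0\<close> or \<open>\<chi>\<eta> = 1\<close>: the two
  evaluations of \<open>y x g\<close> differ by \<open>(\<chi>(g) \<eta>(g) - 1) \<beta> g (1 - cb)\<close>. For instance
  \<open>G = \<int>\<^sup>2\<close> generated by \<open>s, t\<close> with \<open>b = s\<close>, \<open>c = 1\<close>, \<open>\<eta> = 1\<close>, \<open>\<chi>(s) = 1\<close>,
  \<open>\<chi>(t) = 2\<close>, \<open>\<beta> = 1\<close> satisfies \<open>\<eta>(b) = \<chi>(c)\<^sup>-\<^sup>1\<close> but violates the condition.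
\<close>

lemma hopf_parameter_condition:
  fixes \<chi> \<eta> :: "'g::group_add \<Rightarrow> 'k::field" and b c :: 'g and \<beta> :: 'k
    and \<delta> :: "(nat \<Rightarrow>\<^sub>0 'g \<Rightarrow>\<^sub>0 'k) \<Rightarrow> (nat \<Rightarrow>\<^sub>0 'g \<Rightarrow>\<^sub>0 'k)"
  defines "H \<equiv> second_ore \<chi> \<eta> b \<delta>"
    and "elem \<equiv> (\<lambda>g. ore_const (ore_const (group_elem g)))"
    and "x \<equiv> ore_const (ore_var group_algebra)"
    and "y \<equiv> ore_var (first_ore \<chi>)"
  assumes cen: "b \<in> group_center" "c \<in> group_center"
    and alg: "assoc_algebra H"
    and xg: "\<forall>g. alg_mult H x (elem g) = alg_scale H (\<chi> g) (alg_mult H (elem g) x)"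
    and yg: "\<forall>g. alg_mult H y (elem g) = alg_scale H (\<eta> g) (alg_mult H (elem g) y)"
    and yx: "alg_mult H y x = alg_scale H q (alg_mult H x y) + alg_scale H \<beta> (alg_one H - elem (c + b))"
  shows "\<beta> = 0 \<or> c + b = 0 \<or> (\<forall>g. \<chi> g * \<eta> g = 1)"
proof (rule ccontr)
  interpret assoc_algebra H by fact
  assume "\<not> ?thesis"
  then obtain g where nz: "\<beta> \<noteq> 0" "c + b \<noteq> 0" and g: "\<chi> g * \<eta> g \<noteq> 1" by auto
  let ?m = "alg_mult H" and ?s = "alg_scale H"
  have mm: "?m (elem g) (elem h) = elem (g + h)" for g h
    unfolding H_def second_ore_def elem_def ore_const_def group_elem_def first_ore_def
    apply (subst ore_mult_single0)
    apply (rule ore_mult_zero)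
    apply (simp_all add: group_algebra_def winding_group_single[of _ 0 0, simplified] ore_mult_zero(2))
    apply (subst ore_mult_single0)
    apply (simp_all add: mult_single)
    done
  have one: "alg_one H = elem 0"
    unfolding H_def second_ore_def ore_extension_def elem_def ore_const_def group_elem_def first_ore_def group_algebra_def
    by simp
  have sub_right: "?m u (v - w) = ?m u v - ?m u w" "?m (v - w) u = ?m v u - ?m w u" for u v w
    using add_right[of u "v - w" w] add_left[of "v - w" w u] by auto
  have cent: "g + (c + b) = (c + b) + g" using cen unfolding group_center_def
    by (metis (mono_tags, lifting) add.assoc mem_Collect_eq)
  let ?d = "elem g - elem (g + (c + b))"
  let ?E = "?s q (?m (elem g) (?m x y))"
  have L: "?m y (?m x (elem g)) = ?s (\<chi> g * \<eta> g) (?E + ?s \<beta> ?d)"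
  proof -
    have "?m y (?m x (elem g)) = ?s (\<chi> g) (?m (?m y (elem g)) x)"
      using xg by (simp add: scale_mult_right mult_assoc)
    also have "\<dots> = ?s (\<chi> g * \<eta> g) (?m (elem g) (?m y x))"
      using yg by (simp add: scale_mult_left mult_assoc)
    also have "?m (elem g) (?m y x) = ?E + ?s \<beta> ?d"
      unfolding yx one by (simp add: add_right scale_mult_right sub_right mm)
    finally show ?thesis .
  qed
  have R: "?m (?m y x) (elem g) = ?s (\<chi> g * \<eta> g) ?E + ?s \<beta> ?d"
  proof -
    have "?m (?m x y) (elem g) = ?s (\<chi> g * \<eta> g) (?m (elem g) (?m x y))"
    proof -
      have "?m (?m x y) (elem g) = ?s (\<eta> g) (?m (?m x (elem g)) y)"
        using yg by (simp add: scale_mult_right mult_assoc)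
      then show ?thesis using xg by (simp add: scale_mult_left mult_assoc mult.commute)
    qed
    then show ?thesis
      unfolding yx one by (simp add: add_left scale_mult_left sub_right mm cent mult.commute)
  qed
  have "?s ((\<chi> g * \<eta> g - 1) * \<beta>) ?d = 0"
    using L R mult_assoc[of y x "elem g"] 
    by (simp add: scale_right_distrib scale_left_diff_distrib left_diff_distrib)
  then have "?d = 0" using nz g by (metis eq_iff_diff_eq_0 mult_eq_0_iff scale_eq_0_iff)
  then have "Poly_Mapping.single g (1::'k) = Poly_Mapping.single (g + (c + b)) 1"
    unfolding elem_def ore_const_def group_elem_def by (metis lookup_single_eq eq_iff_diff_eq_0)
  then have "g = g + (c + b)"
    by (metis lookup_single_eq lookup_single_not_eq zero_neq_one)
  with nz show False using add_left_cancel[of g 0 "c + b"] by simp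
qed

end

theory Submission
  imports Defs "HOL-Library.Product_Plus"
begin

text \<open>
  Write \<open>R = K[G][x; \<tau>\<^sub>\<chi>]\<close>, let \<open>q = \<eta>(b) = \<chi>(c)\<^sup>-\<^sup>1\<close>, and let \<open>\<sigma> = \<tau>\<^sub>\<eta>\<close>. Everything rests
  on one universal property: a homomorphism \<open>f\<close> from an algebra \<open>A\<close> to an algebra \<open>B\<close>
  extends to \<open>A[x; \<sigma>, \<delta>]\<close> with \<open>x \<mapsto> t\<close> as soon as
  \<open>t f(r) = f(\<sigma>(r)) t + f(\<delta>(r))\<close> for \<open>r\<close> in a generating set of \<open>A\<close>
  (\<open>ore_lift_hom\<close>). Applied twice, it says that the iterated extension \<open>H\<close> is the algebra
  presented by \<open>G\<close>, \<open>x\<close>, \<open>y\<close> and the three commutation rules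
  (\<open>presentation_lift\<close>). All the maps that are needed then come from elements that satisfy
  these rules.

  The derivation. A linear map \<open>\<delta>\<close> is a \<open>\<sigma>\<close>-derivation of \<open>R\<close> exactly when
  \<open>r \<mapsto> (\<sigma>(r), \<delta>(r); 0, r)\<close> is a homomorphism into upper triangular matrices. So \<open>\<delta>\<close>
  with \<open>\<delta>(g) = 0\<close> and \<open>\<delta>(x) = \<beta>(1 - cb)\<close> exists if the matrices
  \<open>(\<eta>(g)g, 0; 0, g)\<close> and \<open>(qx, \<beta>(1 - cb); 0, x)\<close> satisfy the relations of \<open>R\<close>. The
  off-diagonal entry of \<open>xg = \<chi>(g)gx\<close> reads
  \<open>\<beta>(1 - cb)g = \<chi>(g)\<eta>(g) \<beta>g(1 - cb)\<close>, and this is where the condition on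
  \<open>\<beta>\<close>, \<open>cb\<close> and \<open>\<chi>\<eta>\<close> enters (\<open>skew_derivation_exists\<close>).

  The Hopf structure. The comultiplication is the lift into \<open>H \<otimes> H\<close> of
  \<open>g \<mapsto> g \<otimes> g\<close>, \<open>x \<mapsto> x \<otimes> 1 + b \<otimes> x\<close>, \<open>y \<mapsto> y \<otimes> 1 + c \<otimes> y\<close>. The
  relation for \<open>yx\<close> is preserved because the mixed terms cancel: \<open>yb = q by\<close> and
  \<open>cx = q xc\<close>, the latter being \<open>q = \<chi>(c)\<^sup>-\<^sup>1\<close> (\<open>skew_primitive_q_commutation\<close>). The
  counit kills \<open>x\<close> and \<open>y\<close>, and the antipode is the lift into the opposite algebra of
  \<open>g \<mapsto> g\<^sup>-\<^sup>1\<close>, \<open>x \<mapsto> -b\<^sup>-\<^sup>1x\<close>, \<open>y \<mapsto> -c\<^sup>-\<^sup>1y\<close>. Each Hopf algebra axiom need only be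
  checked on the generators (\<open>hopf_algebra_from_generators\<close>), where it is immediate.

  Since \<open>H \<otimes> H\<close> is given by representatives, homomorphisms into it are treated as linear
  maps into the algebra of formal sums of pairs which are multiplicative modulo the two-sided ideal
  spanned by the bilinearity relations. The universal properties are therefore all proved for
  homomorphisms modulo an ideal; the ideal \<open>{0}\<close> gives the ordinary ones.
\<close>

section \<open>Linear extension from a basis\<close>

lemma free_vector_space: "vector_space (free_scale :: 'k::field \<Rightarrow> ('i \<Rightarrow>\<^sub>0 'k) \<Rightarrow> _)"
  by unfold_locales
    (auto intro!: poly_mapping_eqI simp: lookup_coeff_scale lookup_add algebra_simps)

interpretation free: vector_space "free_scale :: 'k::field \<Rightarrow> ('i \<Rightarrow>\<^sub>0 'k) \<Rightarrow> _"
  by (rule free_vector_space)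

lemma free_scale_single [simp]:
  "free_scale k (Poly_Mapping.single i l) = Poly_Mapping.single i (k * l)"
  by (simp add: coeff_scale_single)

lemma vector_spaces_linearI:
  assumes "vector_space s1" "vector_space s2"
    and "\<And>u v. f (u + v) = f u + f v" "\<And>k u. f (s1 k u) = s2 k (f u)"
  shows "Vector_Spaces.linear s1 s2 f"
proof -
  interpret v1: vector_space s1 by fact
  interpret v2: vector_space s2 by fact
  show ?thesis by unfold_locales (fact assms)+
qed

lemma linear_rules:
  assumes "Vector_Spaces.linear s1 s2 f"
  shows "f (u + v) = f u + f v" "f (s1 k u) = s2 k (f u)" "f 0 = 0" "f (u - v) = f u - f v"
    "f (sum g T) = (\<Sum>i\<in>T. f (g i))"
proof -
  interpret Vector_Spaces.linear s1 s2 f by fact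
  show "f (u + v) = f u + f v" "f (s1 k u) = s2 k (f u)" "f 0 = 0" "f (u - v) = f u - f v"
    "f (sum g T) = (\<Sum>i\<in>T. f (g i))"
    by (simp_all add: add scale zero diff sum)
qed

lemma linear_comp:
  assumes "Vector_Spaces.linear s1 s2 f" "Vector_Spaces.linear s2 s3 g"
  shows "Vector_Spaces.linear s1 s3 (\<lambda>u. g (f u))"
  using Vector_Spaces.linear_compose[OF assms] by (simp add: comp_def)

lemma lin_ext_over:
  assumes "vector_space s" "finite K" "Poly_Mapping.keys t \<subseteq> K"
  shows "lin_ext s f t = (\<Sum>i\<in>K. s (Poly_Mapping.lookup t i) (f i))"
proof -
  interpret vector_space s by fact
  show ?thesis
    unfolding lin_ext_def using assms(2,3)
    by (intro sum.mono_neutral_left) (auto simp: in_keys_iff)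
qed

lemma lin_ext_linear:
  assumes "vector_space s"
  shows "Vector_Spaces.linear free_scale s (lin_ext s f)"
proof -
  interpret vector_space s by fact
  show ?thesis
  proof (rule vector_spaces_linearI[OF free_vector_space assms])
    show "lin_ext s f (p + q) = lin_ext s f p + lin_ext s f q" for p q
      by (rule lin_ext_add) (simp_all add: scale_left_distrib)
    show "lin_ext s f (free_scale k p) = s k (lin_ext s f p)" for k p
    proof -
      have "Poly_Mapping.keys (free_scale k p) \<subseteq> Poly_Mapping.keys p"
        by (auto simp: in_keys_iff lookup_coeff_scale)
      then show ?thesis
        by (simp add: lin_ext_over[OF assms, of "Poly_Mapping.keys p"] lookup_coeff_scale
            scale_sum_right)
    qed
  qed
qed

lemma lin_ext_basis:
  assumes "vector_space s"
  shows "lin_ext s f (Poly_Mapping.single i k) = s k (f i)"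
proof -
  interpret vector_space s by fact
  show ?thesis by (rule lin_ext_single) simp
qed

lemma linear_lin_ext:
  assumes "Vector_Spaces.linear s s' L"
  shows "L (lin_ext s f t) = lin_ext s' (\<lambda>i. L (f i)) t"
  by (simp add: lin_ext_def linear_rules[OF assms])

lemma lin_ext_in_subspace:
  assumes "vector_space s" "module.subspace s J" "\<And>i. f i \<in> J"
  shows "lin_ext s f t \<in> J"
proof -
  interpret vector_space s by fact
  show ?thesis
    unfolding lin_ext_def using assms(2,3) by (intro subspace_sum subspace_scale)
qed

lemma lin_ext_fun_diff:
  assumes "vector_space s"
  shows "lin_ext s (\<lambda>i. f i - g i) t = lin_ext s f t - lin_ext s g t"
proof -
  interpret vector_space s by fact
  show ?thesis by (simp add: lin_ext_def scale_right_diff_distrib sum_subtractf)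
qed

lemma lin_ext_fun_add:
  assumes "vector_space s"
  shows "lin_ext s (\<lambda>i. f i + g i) t = lin_ext s f t + lin_ext s g t"
proof -
  interpret vector_space s by fact
  show ?thesis by (simp add: lin_ext_def scale_right_distrib sum.distrib)
qed

lemma lin_ext_fun_scale:
  assumes "vector_space s"
  shows "lin_ext s (\<lambda>i. s k (f i)) t = s k (lin_ext s f t)"
proof -
  interpret vector_space s by fact
  show ?thesis by (simp add: lin_ext_def scale_sum_right mult.commute)
qed

lemma basis_expansion: "lin_ext free_scale (\<lambda>i. Poly_Mapping.single i 1) t = t"
proof (rule poly_mapping_eqI)
  fix j
  show "Poly_Mapping.lookup (lin_ext free_scale (\<lambda>i. Poly_Mapping.single i 1) t) j
      = Poly_Mapping.lookup t j"
    by (simp add: lin_ext_def lookup_sum lookup_single when_def in_keys_iff)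
qed

lemma linear_eq_lin_ext:
  assumes "Vector_Spaces.linear free_scale s L"
  shows "L t = lin_ext s (\<lambda>i. L (Poly_Mapping.single i 1)) t"
  using linear_lin_ext[OF assms, of "\<lambda>i. Poly_Mapping.single i 1" t]
  by (simp add: basis_expansion)

section \<open>Algebra homomorphisms modulo an ideal\<close>

text \<open>
  The quotient by an ideal that depends on parameters is not a type. Working with congruence modulo
  the ideal in the algebra itself replaces it.
\<close>

definition eq_mod :: "'a::ab_group_add set \<Rightarrow> 'a \<Rightarrow> 'a \<Rightarrow> bool" where
  "eq_mod I u v \<longleftrightarrow> u - v \<in> I"

lemma eq_mod_zero [simp]: "eq_mod {0} u v \<longleftrightarrow> u = v"
  by (simp add: eq_mod_def)

locale algebra_with_ideal = assoc_algebra B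
  for B :: "('k::field, 'a::ab_group_add) kalg" +
  fixes I :: "'a set"
  assumes subspace_ideal: "subspace I"
    and ideal_left: "u \<in> I \<Longrightarrow> alg_mult B v u \<in> I"
    and ideal_right: "u \<in> I \<Longrightarrow> alg_mult B u v \<in> I"

context assoc_algebra
begin

lemma scale_vector_space: "vector_space (alg_scale A)" ..

lemma mult_linear:
  "Vector_Spaces.linear (alg_scale A) (alg_scale A) (\<lambda>u. alg_mult A u v)"
  "Vector_Spaces.linear (alg_scale A) (alg_scale A) (alg_mult A u)"
  by (rule vector_spaces_linearI[OF scale_vector_space scale_vector_space],
      simp_all add: add_left add_right scale_mult_left scale_mult_right)+

lemmas mult_diff_left = linear_rules(4)[OF mult_linear(1)]
lemmas mult_diff_right = linear_rules(4)[OF mult_linear(2)]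
lemmas mult_zero_left = linear_rules(3)[OF mult_linear(1)]
lemmas mult_zero_right = linear_rules(3)[OF mult_linear(2)]

lemma zero_ideal: "algebra_with_ideal A {0}"
  by unfold_locales (auto simp: subspace_def mult_zero_left mult_zero_right)

end

context algebra_with_ideal
begin

lemma eq_refl [simp]: "eq_mod I u u"
  using subspace_0[OF subspace_ideal] by (simp add: eq_mod_def)

lemma eq_sym: "eq_mod I u v \<Longrightarrow> eq_mod I v u"
  using subspace_neg[OF subspace_ideal] by (force simp: eq_mod_def)

lemma eq_trans [trans]: "eq_mod I u v \<Longrightarrow> eq_mod I v w \<Longrightarrow> eq_mod I u w"
  using subspace_add[OF subspace_ideal, of "u - v" "v - w"] by (simp add: eq_mod_def)

lemma eq_add: "eq_mod I u v \<Longrightarrow> eq_mod I u' v' \<Longrightarrow> eq_mod I (u + u') (v + v')"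
  using subspace_add[OF subspace_ideal, of "u - v" "u' - v'"]
  by (simp add: eq_mod_def algebra_simps)

lemma eq_diff: "eq_mod I u v \<Longrightarrow> eq_mod I u' v' \<Longrightarrow> eq_mod I (u - u') (v - v')"
  using subspace_diff[OF subspace_ideal, of "u - v" "u' - v'"]
  by (simp add: eq_mod_def algebra_simps)

lemma eq_scale: "eq_mod I u v \<Longrightarrow> eq_mod I (alg_scale B k u) (alg_scale B k v)"
  using subspace_scale[OF subspace_ideal, of "u - v" k]
  by (simp add: eq_mod_def scale_right_diff_distrib)

lemma eq_mult:
  assumes "eq_mod I u v" "eq_mod I u' v'"
  shows "eq_mod I (alg_mult B u u') (alg_mult B v v')"
proof -
  have "alg_mult B (u - v) u' + alg_mult B v (u' - v') \<in> I"
    using assms by (intro subspace_add[OF subspace_ideal] ideal_left ideal_right)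
      (simp_all add: eq_mod_def)
  then show ?thesis by (simp add: eq_mod_def mult_diff_left mult_diff_right)
qed

lemma eq_lin_ext:
  "(\<And>i. eq_mod I (f i) (g i)) \<Longrightarrow> eq_mod I (lin_ext (alg_scale B) f t) (lin_ext (alg_scale B) g t)"
  using lin_ext_in_subspace[OF scale_vector_space subspace_ideal, of "\<lambda>i. f i - g i" t]
  by (simp add: eq_mod_def lin_ext_fun_diff[OF scale_vector_space])

end

text \<open>
  Linearity is required on the nose. Maps defined on a basis have linear representatives, and exact
  linearity lets such a map be applied to finite sums without leaving a congruence behind.
\<close>

definition hom_mod :: "('k::field, 'a::ab_group_add) kalg \<Rightarrow> ('k, 'b::ab_group_add) kalg \<Rightarrow> 'b set \<Rightarrow> ('a \<Rightarrow> 'b) \<Rightarrow> bool"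
where
  "hom_mod A B I f \<longleftrightarrow> Vector_Spaces.linear (alg_scale A) (alg_scale B) f \<and>
     eq_mod I (f (alg_one A)) (alg_one B) \<and>
     (\<forall>u v. eq_mod I (f (alg_mult A u v)) (alg_mult B (f u) (f v)))"

lemma hom_modD:
  assumes "hom_mod A B I f"
  shows "Vector_Spaces.linear (alg_scale A) (alg_scale B) f"
    "eq_mod I (f (alg_one A)) (alg_one B)"
    "eq_mod I (f (alg_mult A u v)) (alg_mult B (f u) (f v))"
  using assms by (auto simp: hom_mod_def)

lemma hom_mod_comp:
  assumes "algebra_with_ideal C J" "hom_mod A B I f" "hom_mod B C J g"
    and "\<And>u. u \<in> I \<Longrightarrow> g u \<in> J"
  shows "hom_mod A C J (\<lambda>u. g (f u))"
proof -
  interpret algebra_with_ideal C J by fact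
  note f = hom_modD[OF assms(2)] and g = hom_modD[OF assms(3)]
  have *: "eq_mod J (g u) (g v)" if "eq_mod I u v" for u v
    using that assms(4)[of "u - v"] by (simp add: eq_mod_def linear_rules[OF g(1)])
  show ?thesis
    unfolding hom_mod_def
    using linear_comp[OF f(1) g(1)] eq_trans[OF *[OF f(2)] g(2)] eq_trans[OF *[OF f(3)] g(3)]
    by auto
qed

lemma hom_mod_id: "assoc_algebra A \<Longrightarrow> hom_mod A A {0} (\<lambda>u. u)"
  by (auto simp: hom_mod_def assoc_algebra_def intro!: vector_spaces_linearI)

abbreviation (input) generates :: "('k, 'a::ab_group_add) kalg \<Rightarrow> 'a set \<Rightarrow> bool" where
  "generates A X \<equiv> subalgebra_generated A X = UNIV"

lemma generates_induct [consumes 1, case_names base one scale add mult]: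
  assumes "generates A X"
    and "\<And>u. u \<in> X \<Longrightarrow> P u" and "P (alg_one A)"
    and "\<And>k u. P u \<Longrightarrow> P (alg_scale A k u)"
    and "\<And>u v. P u \<Longrightarrow> P v \<Longrightarrow> P (u + v)"
    and "\<And>u v. P u \<Longrightarrow> P v \<Longrightarrow> P (alg_mult A u v)"
  shows "P u"
proof -
  have "u \<in> subalgebra_generated A X" using assms(1) by simp
  then show ?thesis by induction (use assms(2-) in blast)+
qed

text \<open>
  The elements on which two homomorphisms agree modulo \<open>I\<close> form a subalgebra. This is what reduces
  coassociativity and the counit laws to the generators.
\<close>

lemma hom_mod_unique:
  assumes "algebra_with_ideal B I" "hom_mod A B I f" "hom_mod A B I g"
    and gen: "generates A X" and agree: "\<And>u. u \<in> X \<Longrightarrow> eq_mod I (f u) (g u)"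
  shows "eq_mod I (f u) (g u)"
proof -
  interpret algebra_with_ideal B I by fact
  note f = hom_modD[OF assms(2)] and g = hom_modD[OF assms(3)]
  show ?thesis
    using gen
  proof (induction u rule: generates_induct)
    case one
    show ?case using eq_trans[OF f(2) eq_sym[OF g(2)]] .
  next
    case (mult u v)
    show ?case
      using eq_trans[OF eq_trans[OF f(3) eq_mult[OF mult]] eq_sym[OF g(3)]] .
  qed (simp_all add: agree linear_rules[OF f(1)] linear_rules[OF g(1)] eq_scale eq_add)
qed

section \<open>Monoid algebras\<close>

text \<open>
  The monoid algebra of the operation \<open>m\<close> with neutral element \<open>e\<close>. It covers the group algebra,
  and also the algebras of formal sums of pairs and of triples that represent tensors.
\<close>

definition formal_algebra :: "('i \<Rightarrow> 'i \<Rightarrow> 'i) \<Rightarrow> 'i \<Rightarrow> ('k::field, 'i \<Rightarrow>\<^sub>0 'k) kalg" where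
  "formal_algebra m e =
     \<lparr>alg_scale = free_scale,
      alg_mult = (\<lambda>s t. lin_ext free_scale
        (\<lambda>i. lin_ext free_scale (\<lambda>j. Poly_Mapping.single (m i j) 1) t) s),
      alg_one = Poly_Mapping.single e 1\<rparr>"

lemma formal_scale [simp]: "alg_scale (formal_algebra m e) = free_scale"
  by (simp add: formal_algebra_def)

lemma formal_one [simp]: "alg_one (formal_algebra m e) = Poly_Mapping.single e 1"
  by (simp add: formal_algebra_def)

lemmas lin_ext_free_rules = linear_rules[OF lin_ext_linear[OF free_vector_space]]

lemma lin_ext_free_single: "lin_ext free_scale f (Poly_Mapping.single i k) = free_scale k (f i)"
  by (rule lin_ext_basis[OF free_vector_space])

lemma formal_mult_single [simp]:
  "alg_mult (formal_algebra m e) (Poly_Mapping.single i k) (Poly_Mapping.single j l)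
     = Poly_Mapping.single (m i j) (k * l)"
  by (simp add: formal_algebra_def lin_ext_free_single)

lemma formal_mult_linear:
  "Vector_Spaces.linear free_scale free_scale (\<lambda>s. alg_mult (formal_algebra m e) s t)"
  "Vector_Spaces.linear free_scale free_scale (\<lambda>t. alg_mult (formal_algebra m e) s t)"
  by (rule vector_spaces_linearI[OF free_vector_space free_vector_space],
      simp_all add: formal_algebra_def lin_ext_free_rules lin_ext_fun_add[OF free_vector_space]
        lin_ext_fun_scale[OF free_vector_space])+

lemma linear_free_eqI:
  assumes "Vector_Spaces.linear free_scale s L" "Vector_Spaces.linear free_scale s L'"
    and "\<And>i. L (Poly_Mapping.single i 1) = L' (Poly_Mapping.single i 1)"
  shows "L t = L' t"
  by (subst linear_eq_lin_ext[OF assms(1)], subst linear_eq_lin_ext[OF assms(2)])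
    (simp only: assms(3))

lemma assoc_formal_algebra:
  assumes "\<And>i j l. m (m i j) l = m i (m j l)" "\<And>i. m e i = i" "\<And>i. m i e = i"
  shows "assoc_algebra (formal_algebra m e :: ('k::field, 'i \<Rightarrow>\<^sub>0 'k) kalg)" (is "assoc_algebra ?F")
proof -
  note lin = formal_mult_linear[of m e]
  note c = linear_comp
  have id: "Vector_Spaces.linear free_scale free_scale (\<lambda>s :: 'i \<Rightarrow>\<^sub>0 'k. s)"
    by (rule vector_spaces_linearI[OF free_vector_space free_vector_space]) simp_all
  show ?thesis
  proof
    fix u v w :: "'i \<Rightarrow>\<^sub>0 'k" and k :: 'k
    let ?b = "\<lambda>i. Poly_Mapping.single i 1 :: 'i \<Rightarrow>\<^sub>0 'k"
    have 1: "alg_mult ?F (alg_mult ?F (?b i) (?b j)) w = alg_mult ?F (?b i) (alg_mult ?F (?b j) w)"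
      for i j
      by (rule linear_free_eqI[OF lin(2) c[OF lin(2) lin(2)]]) (simp add: assms)
    have 2: "alg_mult ?F (alg_mult ?F (?b i) v) w = alg_mult ?F (?b i) (alg_mult ?F v w)" for i
      by (rule linear_free_eqI[OF c[OF lin(2) lin(1)] c[OF lin(1) lin(2)] 1])
    show "alg_mult ?F (alg_mult ?F u v) w = alg_mult ?F u (alg_mult ?F v w)"
      by (rule linear_free_eqI[OF c[OF lin(1) lin(1)] lin(1) 2])
    show "alg_mult ?F (alg_one ?F) u = u"
      by (rule linear_free_eqI[OF lin(2) id]) (simp add: assms)
    show "alg_mult ?F u (alg_one ?F) = u"
      by (rule linear_free_eqI[OF lin(1) id]) (simp add: assms)
  qed (simp_all add: linear_rules[OF lin(1)] linear_rules[OF lin(2)] free.scale_right_distrib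
      free.scale_left_distrib)
qed

text \<open>
  Universal property of the monoid algebra: both sides of the product rule are bilinear, so it
  suffices that \<open>\<phi>\<close> respects products of basis elements modulo the ideal.
\<close>

lemma formal_lift:
  assumes "algebra_with_ideal B I"
    and one: "eq_mod I (\<phi> e) (alg_one B)"
    and mult: "\<And>i j. eq_mod I (\<phi> (m i j)) (alg_mult B (\<phi> i) (\<phi> j))"
  shows "hom_mod (formal_algebra m e) B I (lin_ext (alg_scale B) \<phi>)"
proof -
  interpret algebra_with_ideal B I by fact
  note lin = lin_ext_linear[OF scale_vector_space]
  let ?L = "lin_ext (alg_scale B) \<phi>"
  have "eq_mod I (?L (alg_mult (formal_algebra m e) s t)) (alg_mult B (?L s) (?L t))" for s t
  proof -
    have l: "?L (alg_mult (formal_algebra m e) s t)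
        = lin_ext (alg_scale B) (\<lambda>i. lin_ext (alg_scale B) (\<lambda>j. \<phi> (m i j)) t) s"
      by (simp add: formal_algebra_def linear_lin_ext[OF lin] lin_ext_basis[OF scale_vector_space])
    have r: "alg_mult B (?L s) (?L t)
        = lin_ext (alg_scale B) (\<lambda>i. lin_ext (alg_scale B) (\<lambda>j. alg_mult B (\<phi> i) (\<phi> j)) t) s"
      by (subst linear_lin_ext[OF mult_linear(1)]) (simp add: linear_lin_ext[OF mult_linear(2)])
    show ?thesis unfolding l r by (intro eq_lin_ext mult)
  qed
  then show ?thesis
    using lin one by (simp add: hom_mod_def lin_ext_basis[OF scale_vector_space])
qed

section \<open>Ore extensions\<close>

lemma poly_mapping_add_induct [case_names zero single add]:
  fixes p :: "'i \<Rightarrow>\<^sub>0 'a::ab_group_add"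
  assumes "P 0" "\<And>i r. P (Poly_Mapping.single i r)" "\<And>p q. P p \<Longrightarrow> P q \<Longrightarrow> P (p + q)"
  shows "P p"
proof -
  have *: "P (\<Sum>i\<in>K. Poly_Mapping.single i (Poly_Mapping.lookup p i))" if "finite K" for K
    using that by induction (simp_all add: assms)
  have "p = (\<Sum>i\<in>Poly_Mapping.keys p. Poly_Mapping.single i (Poly_Mapping.lookup p i))"
    by (rule poly_mapping_eqI) (simp add: lookup_sum lookup_single when_def in_keys_iff)
  then show ?thesis using *[of "Poly_Mapping.keys p"] by simp
qed

definition alg_pow :: "('k, 'a) kalg \<Rightarrow> 'a \<Rightarrow> nat \<Rightarrow> 'a" where
  "alg_pow B t i = (alg_mult B t ^^ i) (alg_one B)"

lemma alg_pow_simps [simp]: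
  "alg_pow B t 0 = alg_one B" "alg_pow B t (Suc i) = alg_mult B t (alg_pow B t i)"
  by (simp_all add: alg_pow_def)

text \<open>
  The map \<open>\<Sum>\<^sub>i p\<^sub>i x\<^sup>i \<mapsto> \<Sum>\<^sub>i f(p\<^sub>i) t\<^sup>i\<close>, the only candidate for a homomorphism that
  extends \<open>f\<close> and sends \<open>x\<close> to \<open>t\<close>.
\<close>

definition ore_lift :: "('k, 'b::ab_group_add) kalg \<Rightarrow> ('a::zero \<Rightarrow> 'b) \<Rightarrow> 'b \<Rightarrow> (nat \<Rightarrow>\<^sub>0 'a) \<Rightarrow> 'b" where
  "ore_lift B f t p = (\<Sum>i\<in>Poly_Mapping.keys p. alg_mult B (f (Poly_Mapping.lookup p i)) (alg_pow B t i))"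

lemma lookup_ore_var_mult:
  assumes "\<sigma> 0 = 0" "\<delta> 0 = 0"
  shows "Poly_Mapping.lookup (ore_var_mult \<sigma> \<delta> p) j =
    (case j of 0 \<Rightarrow> 0 | Suc i \<Rightarrow> \<sigma> (Poly_Mapping.lookup p i)) + \<delta> (Poly_Mapping.lookup p j)"
  by (cases j) (simp_all add: ore_var_mult_def lookup_sum lookup_add lookup_single when_def
      sum.distrib in_keys_iff assms)

locale ore_data = assoc_algebra A
  for A :: "('k::field, 'a::ab_group_add) kalg" +
  fixes \<sigma> \<delta> :: "'a \<Rightarrow> 'a"
  assumes twist_hom: "hom_mod A A {0} \<sigma>"
    and deriv: "skew_derivation A \<sigma> \<delta>"
begin

abbreviation "Ore \<equiv> ore_extension A \<sigma> \<delta>"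
abbreviation "M \<equiv> ore_var_mult \<sigma> \<delta>"
abbreviation coeff_mult (infixr "\<bullet>" 75) where "r \<bullet> p \<equiv> coeff_scale (alg_mult A) r p"

lemmas twist_rules = linear_rules[OF hom_modD(1)[OF twist_hom]]
  and twist_one = hom_modD(2)[OF twist_hom, simplified]
  and twist_mult = hom_modD(3)[OF twist_hom, simplified]

lemma deriv_linear: "Vector_Spaces.linear (alg_scale A) (alg_scale A) \<delta>"
  and deriv_mult: "\<delta> (alg_mult A r s) = alg_mult A (\<sigma> r) (\<delta> s) + alg_mult A (\<delta> r) s"
  using deriv by (auto simp: skew_derivation_def)

lemmas deriv_rules = linear_rules[OF deriv_linear]

lemma deriv_one: "\<delta> (alg_one A) = 0"
  using deriv_mult[of "alg_one A" "alg_one A"] by (simp add: twist_one one_left one_right)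

lemmas lookup_M = lookup_ore_var_mult[of \<sigma> \<delta>, OF twist_rules(3) deriv_rules(3)]

lemma lookup_coeff [simp]:
  "Poly_Mapping.lookup (r \<bullet> p) j = alg_mult A r (Poly_Mapping.lookup p j)"
  "Poly_Mapping.lookup (coeff_scale (alg_scale A) k p) j = alg_scale A k (Poly_Mapping.lookup p j)"
  by (simp_all add: lookup_coeff_scale mult_zero_right)

lemma coeff_mult_rules:
  "r \<bullet> (p + q) = r \<bullet> p + r \<bullet> q" "(r + s) \<bullet> p = r \<bullet> p + s \<bullet> p" "r \<bullet> 0 = 0" "0 \<bullet> p = 0"
  "r \<bullet> s \<bullet> p = alg_mult A r s \<bullet> p" "alg_one A \<bullet> p = p"
  "r \<bullet> Poly_Mapping.single i s = Poly_Mapping.single i (alg_mult A r s)"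
  "r \<bullet> coeff_scale (alg_scale A) k p = coeff_scale (alg_scale A) k (r \<bullet> p)"
  "alg_scale A k r \<bullet> p = coeff_scale (alg_scale A) k (r \<bullet> p)"
  by (auto intro!: poly_mapping_eqI simp: lookup_add add_left add_right mult_zero_left mult_zero_right
      mult_assoc one_left lookup_single when_def scale_mult_left scale_mult_right)

lemma ore_vector_space: "vector_space (coeff_scale (alg_scale A) :: 'k \<Rightarrow> (nat \<Rightarrow>\<^sub>0 'a) \<Rightarrow> _)"
  by unfold_locales (auto intro!: poly_mapping_eqI simp: lookup_add scale_right_distrib scale_left_distrib)

lemma M_rules:
  "M (p + q) = M p + M q" "M 0 = 0" "M (r \<bullet> p) = \<sigma> r \<bullet> M p + \<delta> r \<bullet> p"
  "M (Poly_Mapping.single i r) = Poly_Mapping.single (Suc i) (\<sigma> r) + Poly_Mapping.single i (\<delta> r)"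
  "M (coeff_scale (alg_scale A) k p) = coeff_scale (alg_scale A) k (M p)"
  by (auto intro!: poly_mapping_eqI simp: lookup_M lookup_add twist_rules deriv_rules twist_mult
      deriv_mult add_right add_left lookup_single when_def scale_right_distrib mult_zero_right
      split: nat.splits)

lemma M_pow_rules:
  "(M ^^ i) (p + q) = (M ^^ i) p + (M ^^ i) q" "(M ^^ i) 0 = 0"
  "(M ^^ i) (coeff_scale (alg_scale A) k p) = coeff_scale (alg_scale A) k ((M ^^ i) p)"
  by (induction i) (simp_all add: M_rules)

lemma ore_scale [simp]: "alg_scale Ore = coeff_scale (alg_scale A)"
  and ore_one [simp]: "alg_one Ore = Poly_Mapping.single 0 (alg_one A)"
  by (simp_all add: ore_extension_def)

lemma ore_mult_over:
  assumes "finite K" "Poly_Mapping.keys p \<subseteq> K"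
  shows "alg_mult Ore p q = (\<Sum>i\<in>K. Poly_Mapping.lookup p i \<bullet> (M ^^ i) q)"
  unfolding ore_extension_def using assms
  by (auto intro!: sum.mono_neutral_left simp: in_keys_iff coeff_mult_rules)

lemma ore_mult_single: "alg_mult Ore (Poly_Mapping.single i r) q = r \<bullet> (M ^^ i) q"
  by (subst ore_mult_over[of "{i}"]) auto

lemma ore_mult_rules:
  "alg_mult Ore 0 q = 0" "alg_mult Ore p 0 = 0"
  "alg_mult Ore (p + p') q = alg_mult Ore p q + alg_mult Ore p' q"
  "alg_mult Ore p (q + q') = alg_mult Ore p q + alg_mult Ore p q'"
  "alg_mult Ore p (coeff_scale (alg_scale A) k q) = coeff_scale (alg_scale A) k (alg_mult Ore p q)"
proof -
  interpret V: vector_space "coeff_scale (alg_scale A) :: 'k \<Rightarrow> (nat \<Rightarrow>\<^sub>0 'a) \<Rightarrow> _"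
    by (rule ore_vector_space)
  show "alg_mult Ore 0 q = 0" "alg_mult Ore p 0 = 0"
    by (simp_all add: ore_extension_def M_pow_rules)
  let ?K = "Poly_Mapping.keys p \<union> Poly_Mapping.keys p'"
  show "alg_mult Ore (p + p') q = alg_mult Ore p q + alg_mult Ore p' q"
    using Poly_Mapping.keys_add[of p p']
    by (simp add: ore_mult_over[of ?K] lookup_add coeff_mult_rules sum.distrib)
  show "alg_mult Ore p (q + q') = alg_mult Ore p q + alg_mult Ore p q'"
    "alg_mult Ore p (coeff_scale (alg_scale A) k q) = coeff_scale (alg_scale A) k (alg_mult Ore p q)"
    by (simp_all add: ore_mult_over[of "Poly_Mapping.keys p"] M_pow_rules coeff_mult_rules
        sum.distrib V.scale_sum_right)
qed

text \<open>
  \<open>M\<close> is left multiplication by \<open>x\<close> and \<open>r \<bullet> _\<close> is left multiplication by \<open>r\<close>. Associativity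
  amounts to the statement that \<open>p \<mapsto> (q \<mapsto> pq)\<close> is multiplicative. The next lemmas prove this when
  the left factor is \<open>x\<close>, a power of \<open>x\<close> or a coefficient, and every element is a sum of products of
  those. The case of \<open>x\<close> is the rule \<open>M (r \<bullet> p) = \<sigma>(r) \<bullet> M p + \<delta>(r) \<bullet> p\<close>.
\<close>

lemma M_mult: "alg_mult Ore (M p) q = M (alg_mult Ore p q)"
  by (induction p rule: poly_mapping_add_induct)
    (simp_all add: ore_mult_rules M_rules ore_mult_single)

lemma M_pow_mult: "alg_mult Ore ((M ^^ i) p) q = (M ^^ i) (alg_mult Ore p q)"
  by (induction i) (simp_all add: M_mult)

lemma coeff_mult_mult: "alg_mult Ore (r \<bullet> p) q = r \<bullet> alg_mult Ore p q"
  by (induction p rule: poly_mapping_add_induct)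
    (simp_all add: ore_mult_rules coeff_mult_rules ore_mult_single)

lemma coeff_scale_mult:
  "alg_mult Ore (coeff_scale (alg_scale A) k p) q = coeff_scale (alg_scale A) k (alg_mult Ore p q)"
  using coeff_mult_mult[of "alg_scale A k (alg_one A)" p q] by (simp add: coeff_mult_rules)

lemma M_pow_one: "(M ^^ i) (Poly_Mapping.single 0 (alg_one A)) = Poly_Mapping.single i (alg_one A)"
  by (induction i) (simp_all add: M_rules twist_one deriv_one)

lemma assoc_ore: "assoc_algebra Ore"
proof (rule assoc_algebra.intro)
  show "vector_space (alg_scale Ore)" by (simp add: ore_vector_space)
  show "assoc_algebra_axioms Ore"
  proof
    show "alg_mult Ore (alg_mult Ore p q) w = alg_mult Ore p (alg_mult Ore q w)" for p q w
      by (induction p rule: poly_mapping_add_induct)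
        (simp_all add: ore_mult_rules ore_mult_single coeff_mult_mult M_pow_mult)
    show "alg_mult Ore (alg_one Ore) p = p" for p
      by (simp add: ore_mult_single coeff_mult_rules)
    show "alg_mult Ore p (alg_one Ore) = p" for p
      by (induction p rule: poly_mapping_add_induct)
        (simp_all add: ore_mult_rules ore_mult_single M_pow_one coeff_mult_rules one_right)
  qed (simp_all add: ore_mult_rules coeff_scale_mult)
qed

lemma ore_var_mult_eq: "alg_mult Ore (ore_var A) p = M p"
  by (simp add: ore_var_def ore_mult_single coeff_mult_rules)

lemma ore_const_mult_eq: "alg_mult Ore (ore_const r) p = r \<bullet> p"
  by (simp add: ore_const_def ore_mult_single)

lemma hom_ore_const: "hom_mod A Ore {0} ore_const"
  by (auto simp: hom_mod_def ore_mult_single coeff_mult_rules ore_const_def single_add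
      scale_vector_space ore_vector_space
      intro!: vector_spaces_linearI poly_mapping_eqI simp: lookup_single when_def)

lemma ore_commutation:
  "alg_mult Ore (ore_var A) (ore_const r) = alg_mult Ore (ore_const (\<sigma> r)) (ore_var A) + ore_const (\<delta> r)"
  by (simp add: ore_var_mult_eq ore_const_mult_eq)
    (simp add: ore_const_def ore_var_def M_rules coeff_mult_rules one_right)

lemma generates_ore:
  assumes "generates A X"
  shows "generates Ore (ore_const ` X \<union> {ore_var A})"
proof -
  let ?S = "subalgebra_generated Ore (ore_const ` X \<union> {ore_var A})"
  interpret c: algebra_with_ideal Ore "{0}" by (rule assoc_algebra.zero_ideal[OF assoc_ore])
  note ch = hom_modD[OF hom_ore_const]
  have const: "ore_const r \<in> ?S" for r
    using assms
  proof (induction r rule: generates_induct)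
    case one
    show ?case using subalgebra_generated.one[of Ore] ch(2) by simp
  qed (auto intro: subalgebra_generated.intros simp: linear_rules[OF ch(1)] ch(3)[simplified]
      simp del: ore_scale)
  have var: "(M ^^ i) p \<in> ?S" if "p \<in> ?S" for i p
    using that by (induction i)
      (auto simp: ore_var_mult_eq[symmetric] intro: subalgebra_generated.intros)
  have "p \<in> ?S" for p
  proof (induction p rule: poly_mapping_add_induct)
    case zero
    show ?case using const[of 0] by (simp add: ore_const_def)
  next
    case (single i r)
    have "alg_mult Ore (ore_const r) ((M ^^ i) (alg_one Ore)) \<in> ?S"
      by (intro subalgebra_generated.mult const var subalgebra_generated.one)
    then show ?case by (simp add: ore_const_mult_eq M_pow_one coeff_mult_rules one_right)
  qed (rule subalgebra_generated.add)
  then show ?thesis by auto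
qed

end

locale ore_lift_data = ore_data A \<sigma> \<delta> + target: algebra_with_ideal B I
  for A :: "('k::field, 'a::ab_group_add) kalg" and \<sigma> \<delta>
    and B :: "('k, 'b::ab_group_add) kalg" and I +
  fixes f :: "'a \<Rightarrow> 'b" and t :: 'b and X :: "'a set"
  assumes coeff_hom: "hom_mod A B I f"
    and gen: "generates A X"
    and commutation: "r \<in> X \<Longrightarrow> eq_mod I (alg_mult B t (f r)) (alg_mult B (f (\<sigma> r)) t + f (\<delta> r))"
begin

abbreviation "F \<equiv> ore_lift B f t"

lemmas f_rules = linear_rules[OF hom_modD(1)[OF coeff_hom]]
  and f_one = hom_modD(2)[OF coeff_hom]
  and f_mult = hom_modD(3)[OF coeff_hom]

text \<open>
  The commutation rule passes from \<open>r\<close> and \<open>s\<close> to \<open>rs\<close>: moving \<open>t\<close> past \<open>f(r)\<close> and then past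
  \<open>f(s)\<close> produces exactly the terms \<open>f(\<sigma>(r)) f(\<delta>(s)) + f(\<delta>(r)) f(s)\<close> of the twisted
  Leibniz rule. So it holds everywhere once it holds on the generators.
\<close>

lemma commutation_all: "eq_mod I (alg_mult B t (f r)) (alg_mult B (f (\<sigma> r)) t + f (\<delta> r))"
  using gen
proof (induction r rule: generates_induct)
  case one
  have "eq_mod I (alg_mult B t (f (alg_one A))) t"
    using target.eq_mult[OF target.eq_refl f_one, of t] by (simp add: target.one_right)
  moreover have "eq_mod I (alg_mult B (f (alg_one A)) t) t"
    using target.eq_mult[OF f_one target.eq_refl, of t] by (simp add: target.one_left)
  ultimately have "eq_mod I (alg_mult B t (f (alg_one A))) (alg_mult B (f (alg_one A)) t)"
    by (rule target.eq_trans[OF _ target.eq_sym])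
  then show ?case by (simp add: twist_one deriv_one f_rules(3))
next
  case (scale k r)
  then show ?case
    using target.eq_scale[OF scale, of k]
    by (simp add: f_rules twist_rules deriv_rules target.scale_mult_left target.scale_mult_right
        target.scale_right_distrib)
next
  case (add r s)
  then show ?case
    using target.eq_add[OF add]
    by (simp add: f_rules twist_rules deriv_rules target.add_left target.add_right algebra_simps)
next
  case (mult r s)
  let ?m = "alg_mult B"
  have "eq_mod I (?m t (f (alg_mult A r s))) (?m t (?m (f r) (f s)))"
    by (intro target.eq_mult f_mult target.eq_refl)
  also have "?m t (?m (f r) (f s)) = ?m (?m t (f r)) (f s)" by (simp add: target.mult_assoc)
  also have "eq_mod I \<dots> (?m (?m (f (\<sigma> r)) t + f (\<delta> r)) (f s))"
    by (intro target.eq_mult mult target.eq_refl)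
  also have "?m (?m (f (\<sigma> r)) t + f (\<delta> r)) (f s) = ?m (f (\<sigma> r)) (?m t (f s)) + ?m (f (\<delta> r)) (f s)"
    by (simp add: target.add_left target.mult_assoc)
  also have "eq_mod I \<dots> (?m (f (\<sigma> r)) (?m (f (\<sigma> s)) t + f (\<delta> s)) + ?m (f (\<delta> r)) (f s))"
    by (intro target.eq_add target.eq_mult mult target.eq_refl)
  also have "?m (f (\<sigma> r)) (?m (f (\<sigma> s)) t + f (\<delta> s)) + ?m (f (\<delta> r)) (f s)
      = ?m (?m (f (\<sigma> r)) (f (\<sigma> s))) t + (?m (f (\<sigma> r)) (f (\<delta> s)) + ?m (f (\<delta> r)) (f s))"
    by (simp add: target.add_right target.mult_assoc algebra_simps)
  also have "eq_mod I \<dots> (?m (f (alg_mult A (\<sigma> r) (\<sigma> s))) t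
      + (f (alg_mult A (\<sigma> r) (\<delta> s)) + f (alg_mult A (\<delta> r) s)))"
    by (intro target.eq_add target.eq_mult target.eq_sym[OF f_mult] target.eq_refl)
  finally show ?case by (simp add: twist_mult deriv_mult f_rules)
qed (rule commutation)

lemma lift_over:
  assumes "finite K" "Poly_Mapping.keys p \<subseteq> K"
  shows "F p = (\<Sum>i\<in>K. alg_mult B (f (Poly_Mapping.lookup p i)) (alg_pow B t i))"
  unfolding ore_lift_def using assms
  by (auto intro!: sum.mono_neutral_left simp: in_keys_iff f_rules target.mult_zero_left)

lemma lift_single: "F (Poly_Mapping.single i r) = alg_mult B (f r) (alg_pow B t i)"
  by (subst lift_over[of "{i}"]) auto

lemma lift_linear: "Vector_Spaces.linear (alg_scale Ore) (alg_scale B) F"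
proof (rule vector_spaces_linearI)
  show "vector_space (alg_scale Ore)" using ore_vector_space by simp
  show "F (p + q) = F p + F q" for p q
    using Poly_Mapping.keys_add[of p q]
    by (simp add: lift_over[of "Poly_Mapping.keys p \<union> Poly_Mapping.keys q"] lookup_add f_rules
        target.add_left sum.distrib)
  show "F (alg_scale Ore k p) = alg_scale B k (F p)" for k p
  proof -
    have "Poly_Mapping.keys (coeff_scale (alg_scale A) k p) \<subseteq> Poly_Mapping.keys p"
      by (auto simp: in_keys_iff)
    then show ?thesis
      by (simp add: lift_over[of "Poly_Mapping.keys p"] f_rules target.scale_mult_left
          target.scale_sum_right)
  qed
qed (rule target.scale_vector_space)

lemmas lift_rules = linear_rules[OF lift_linear]

lemma lift_M: "eq_mod I (F (M p)) (alg_mult B t (F p))"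
proof (induction p rule: poly_mapping_add_induct)
  case (single i r)
  have "F (M (Poly_Mapping.single i r))
      = alg_mult B (alg_mult B (f (\<sigma> r)) t + f (\<delta> r)) (alg_pow B t i)"
    by (simp add: M_rules lift_rules lift_single target.add_left target.mult_assoc)
  also have "eq_mod I \<dots> (alg_mult B (alg_mult B t (f r)) (alg_pow B t i))"
    by (intro target.eq_mult target.eq_sym[OF commutation_all] target.eq_refl)
  finally show ?case by (simp add: lift_single target.mult_assoc)
next
  case (add p q)
  then show ?case using target.eq_add[OF add] by (simp add: M_rules lift_rules target.add_right)
qed (simp add: M_rules lift_rules target.mult_zero_right)

lemma lift_M_pow: "eq_mod I (F ((M ^^ i) p)) (alg_mult B (alg_pow B t i) (F p))"
proof (induction i)
  case (Suc i)
  show ?case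
    using target.eq_trans[OF lift_M target.eq_mult[OF target.eq_refl Suc, of t]]
    by (simp add: target.mult_assoc)
qed (simp add: target.one_left)

lemma lift_coeff_mult: "eq_mod I (F (r \<bullet> p)) (alg_mult B (f r) (F p))"
proof (induction p rule: poly_mapping_add_induct)
  case (single i s)
  show ?case
    using target.eq_mult[OF f_mult[of r s] target.eq_refl[of "alg_pow B t i"]]
    by (simp add: coeff_mult_rules lift_single target.mult_assoc[symmetric])
next
  case (add p q)
  then show ?case
    using target.eq_add[OF add] by (simp add: coeff_mult_rules lift_rules target.add_right)
qed (simp add: coeff_mult_rules lift_rules target.mult_zero_right)

text \<open>
  Multiplication in the Ore extension is built from left multiplications by coefficients and by
  \<open>x\<close>, and \<open>F\<close> turns these into left multiplications by \<open>f(r)\<close> and by \<open>t\<close>.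
\<close>

theorem ore_lift_hom: "hom_mod Ore B I F"
proof -
  have "eq_mod I (F (alg_mult Ore p q)) (alg_mult B (F p) (F q))" for p q
  proof (induction p rule: poly_mapping_add_induct)
    case (single i r)
    show ?case
      using target.eq_trans[OF lift_coeff_mult target.eq_mult[OF target.eq_refl lift_M_pow],
          of r i q]
      by (simp add: ore_mult_single lift_single target.mult_assoc)
  next
    case (add p p')
    then show ?case
      using target.eq_add[OF add] by (simp add: ore_mult_rules lift_rules target.add_left)
  qed (simp add: ore_mult_rules lift_rules target.mult_zero_left)
  then show ?thesis
    using lift_linear f_one by (simp add: hom_mod_def lift_single target.one_right)
qed

lemma lift_const: "F (ore_const r) = f r"
  by (simp add: ore_const_def lift_single target.one_right)

lemma lift_var: "f (alg_one A) = alg_one B \<Longrightarrow> F (ore_var A) = t"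
  by (simp add: ore_var_def lift_single target.one_left target.one_right)

end

section \<open>Tensor products\<close>

definition tensor_algebra :: "('k::field, 'a::ab_group_add) kalg \<Rightarrow> ('k, ('k, 'a) tensor) kalg" where
  "tensor_algebra A = formal_algebra
     (\<lambda>(u, v) (u', v'). (alg_mult A u u', alg_mult A v v')) (alg_one A, alg_one A)"

definition tensor3_algebra :: "('k::field, 'a::ab_group_add) kalg \<Rightarrow> ('k, ('k, 'a) tensor3) kalg" where
  "tensor3_algebra A = formal_algebra
     (\<lambda>(u, v, w) (u', v', w'). (alg_mult A u u', alg_mult A v v', alg_mult A w w'))
     (alg_one A, alg_one A, alg_one A)"

definition tensor_ideal :: "('k::field, 'a::ab_group_add) kalg \<Rightarrow> ('k, 'a) tensor set" where
  "tensor_ideal A = free.span (tensor_relations A)"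

definition tensor3_ideal :: "('k::field, 'a::ab_group_add) kalg \<Rightarrow> ('k, 'a) tensor3 set" where
  "tensor3_ideal A = free.span (tensor3_relations A)"

lemma tensor_eq_iff: "tensor_eq A s t \<longleftrightarrow> eq_mod (tensor_ideal A) s t"
  by (simp add: tensor_eq_def eq_mod_def tensor_ideal_def)

lemma tensor3_eq_iff: "tensor3_eq A s t \<longleftrightarrow> eq_mod (tensor3_ideal A) s t"
  by (simp add: tensor3_eq_def eq_mod_def tensor3_ideal_def)

lemma tensor_algebra_simps [simp]:
  "alg_scale (tensor_algebra A) = free_scale"
  "alg_one (tensor_algebra A) = ptensor (alg_one A) (alg_one A)"
  "alg_mult (tensor_algebra A) (Poly_Mapping.single (u, v) k) (Poly_Mapping.single (u', v') l)
     = Poly_Mapping.single (alg_mult A u u', alg_mult A v v') (k * l)"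
  "alg_scale (tensor3_algebra A) = free_scale"
  "alg_one (tensor3_algebra A) = ptensor3 (alg_one A) (alg_one A) (alg_one A)"
  "alg_mult (tensor3_algebra A) (Poly_Mapping.single (u, v, w) k) (Poly_Mapping.single (u', v', w') l)
     = Poly_Mapping.single (alg_mult A u u', alg_mult A v v', alg_mult A w w') (k * l)"
  by (simp_all add: tensor_algebra_def tensor3_algebra_def)

lemma tensor_algebra_mult: "alg_mult (tensor_algebra A) = tensor_mult A"
  by (simp add: fun_eq_iff tensor_algebra_def formal_algebra_def tensor_mult_def case_prod_unfold)

lemma tensor_mult_linear:
  "Vector_Spaces.linear free_scale free_scale (\<lambda>s. alg_mult (tensor_algebra A) s t)"
  "Vector_Spaces.linear free_scale free_scale (\<lambda>t. alg_mult (tensor_algebra A) s t)"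
  "Vector_Spaces.linear free_scale free_scale (\<lambda>s'. alg_mult (tensor3_algebra A) s' t')"
  "Vector_Spaces.linear free_scale free_scale (\<lambda>t'. alg_mult (tensor3_algebra A) s' t')"
  by (simp_all add: tensor_algebra_def tensor3_algebra_def formal_mult_linear)

lemma tensor_ideal_linear:
  "eq_mod (tensor_ideal A) (ptensor (u + u') v) (ptensor u v + ptensor u' v)"
  "eq_mod (tensor_ideal A) (ptensor u (v + v')) (ptensor u v + ptensor u v')"
  "eq_mod (tensor_ideal A) (ptensor (alg_scale A k u) v) (free_scale k (ptensor u v))"
  "eq_mod (tensor_ideal A) (ptensor u (alg_scale A k v)) (free_scale k (ptensor u v))"
  unfolding eq_mod_def tensor_ideal_def diff_diff_eq[symmetric]
  by (rule free.span_base; force simp: tensor_relations_def)+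

lemma tensor3_ideal_linear:
  "eq_mod (tensor3_ideal A) (ptensor3 (u + u') v w) (ptensor3 u v w + ptensor3 u' v w)"
  "eq_mod (tensor3_ideal A) (ptensor3 u (v + v') w) (ptensor3 u v w + ptensor3 u v' w)"
  "eq_mod (tensor3_ideal A) (ptensor3 u v (w + w')) (ptensor3 u v w + ptensor3 u v w')"
  "eq_mod (tensor3_ideal A) (ptensor3 (alg_scale A k u) v w) (free_scale k (ptensor3 u v w))"
  "eq_mod (tensor3_ideal A) (ptensor3 u (alg_scale A k v) w) (free_scale k (ptensor3 u v w))"
  "eq_mod (tensor3_ideal A) (ptensor3 u v (alg_scale A k w)) (free_scale k (ptensor3 u v w))"
  unfolding eq_mod_def tensor3_ideal_def diff_diff_eq[symmetric]
  by (rule free.span_base; force simp: tensor3_relations_def)+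

text \<open>
  Multiplication by a general element is a linear combination of multiplications by basis elements,
  so a span is an ideal if the basis elements map its generators into it.
\<close>

lemma formal_span_ideal:
  fixes R :: "('i \<Rightarrow>\<^sub>0 'k::field) set"
  assumes "assoc_algebra (formal_algebra m e :: ('k, 'i \<Rightarrow>\<^sub>0 'k) kalg)"
    and left: "\<And>i r. r \<in> R \<Longrightarrow> alg_mult (formal_algebra m e) (Poly_Mapping.single i 1) r \<in> free.span R"
    and right: "\<And>i r. r \<in> R \<Longrightarrow> alg_mult (formal_algebra m e) r (Poly_Mapping.single i 1) \<in> free.span R"
  shows "algebra_with_ideal (formal_algebra m e) (free.span R)"
proof -
  let ?F = "formal_algebra m e :: ('k, 'i \<Rightarrow>\<^sub>0 'k) kalg"
  interpret assoc_algebra ?F by fact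
  note fl = formal_mult_linear[of m e]
  have basis: "L t \<in> free.span R"
    if "Vector_Spaces.linear free_scale free_scale L"
      "\<And>i. L (Poly_Mapping.single i 1) \<in> free.span R" for t :: "'i \<Rightarrow>\<^sub>0 'k" and L
    by (subst linear_eq_lin_ext[OF that(1)])
      (intro lin_ext_in_subspace free_vector_space free.subspace_span that(2))
  have sub: "free.subspace {s. L s \<in> free.span R}"
    if L: "Vector_Spaces.linear free_scale free_scale L" for L :: "('i \<Rightarrow>\<^sub>0 'k) \<Rightarrow> _"
    by (auto simp: free.subspace_def linear_rules[OF L] free.span_zero
        intro: free.span_add free.span_scale)
  show ?thesis
  proof
    show "subspace (free.span R)" by simp
    fix u v assume u: "u \<in> free.span R"
    have "\<And>r. r \<in> R \<Longrightarrow> alg_mult ?F v r \<in> free.span R"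
      by (rule basis[OF fl(1) left])
    then show "alg_mult ?F v u \<in> free.span R"
      using free.span_minimal[of R, OF _ sub[OF fl(2)]] u by blast
    have "\<And>r. r \<in> R \<Longrightarrow> alg_mult ?F r v \<in> free.span R"
      by (rule basis[OF fl(2) right])
    then show "alg_mult ?F u v \<in> free.span R"
      using free.span_minimal[of R, OF _ sub[OF fl(1)]] u by blast
  qed
qed

context assoc_algebra
begin

lemma tensor_ideal: "algebra_with_ideal (tensor_algebra A) (tensor_ideal A)"
  unfolding tensor_algebra_def tensor_ideal_def
proof (rule formal_span_ideal)
  show "assoc_algebra (formal_algebra (\<lambda>(u, v) (u', v'). (alg_mult A u u', alg_mult A v v'))
      (alg_one A, alg_one A))"
    by (rule assoc_formal_algebra) (auto simp: mult_assoc one_left one_right)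
  note rel = tensor_ideal_linear[of A, unfolded eq_mod_def tensor_ideal_def diff_diff_eq[symmetric]]
  fix i r assume "r \<in> tensor_relations A"
  then show "alg_mult (formal_algebra (\<lambda>(u, v) (u', v'). (alg_mult A u u', alg_mult A v v'))
      (alg_one A, alg_one A)) (Poly_Mapping.single i 1) r \<in> free.span (tensor_relations A)"
    and "alg_mult (formal_algebra (\<lambda>(u, v) (u', v'). (alg_mult A u u', alg_mult A v v'))
      (alg_one A, alg_one A)) r (Poly_Mapping.single i 1) \<in> free.span (tensor_relations A)"
    using rel
    by (cases i; auto simp: tensor_relations_def linear_rules(4)[OF formal_mult_linear(1)]
        linear_rules(4)[OF formal_mult_linear(2)] add_left add_right scale_mult_left scale_mult_right)+
qed

lemma tensor3_ideal: "algebra_with_ideal (tensor3_algebra A) (tensor3_ideal A)"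
  unfolding tensor3_algebra_def tensor3_ideal_def
proof (rule formal_span_ideal)
  show "assoc_algebra (formal_algebra
      (\<lambda>(u, v, w) (u', v', w'). (alg_mult A u u', alg_mult A v v', alg_mult A w w'))
      (alg_one A, alg_one A, alg_one A))"
    by (rule assoc_formal_algebra) (auto simp: mult_assoc one_left one_right)
  note rel = tensor3_ideal_linear[of A, unfolded eq_mod_def tensor3_ideal_def diff_diff_eq[symmetric]]
  fix i r assume "r \<in> tensor3_relations A"
  then show "alg_mult (formal_algebra
      (\<lambda>(u, v, w) (u', v', w'). (alg_mult A u u', alg_mult A v v', alg_mult A w w'))
      (alg_one A, alg_one A, alg_one A)) (Poly_Mapping.single i 1) r \<in> free.span (tensor3_relations A)"
    and "alg_mult (formal_algebra
      (\<lambda>(u, v, w) (u', v', w'). (alg_mult A u u', alg_mult A v v', alg_mult A w w'))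
      (alg_one A, alg_one A, alg_one A)) r (Poly_Mapping.single i 1) \<in> free.span (tensor3_relations A)"
    using rel
    by (cases i; auto simp: tensor3_relations_def linear_rules(4)[OF formal_mult_linear(1)]
        linear_rules(4)[OF formal_mult_linear(2)] add_left add_right scale_mult_left scale_mult_right)+
qed

end

text \<open>
  The universal property of the tensor product, in the form in which it is used to show that maps
  given on representatives respect equality of tensors.
\<close>

lemma bilinear_kills_tensor_ideal:
  assumes B: "algebra_with_ideal B J"
    and "\<And>u u' v. eq_mod J (\<phi> (u + u', v)) (\<phi> (u, v) + \<phi> (u', v))"
    and "\<And>u v v'. eq_mod J (\<phi> (u, v + v')) (\<phi> (u, v) + \<phi> (u, v'))"
    and "\<And>k u v. eq_mod J (\<phi> (alg_scale A k u, v)) (alg_scale B k (\<phi> (u, v)))"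
    and "\<And>k u v. eq_mod J (\<phi> (u, alg_scale A k v)) (alg_scale B k (\<phi> (u, v)))"
    and "s \<in> tensor_ideal A"
  shows "lin_ext (alg_scale B) \<phi> s \<in> J"
proof -
  interpret algebra_with_ideal B J by fact
  let ?L = "lin_ext (alg_scale B) \<phi>"
  note L = lin_ext_linear[OF scale_vector_space, of \<phi>]
  have "free.subspace {s. ?L s \<in> J}"
    using subspace_ideal by (auto simp: free.subspace_def subspace_def linear_rules[OF L])
  moreover have "tensor_relations A \<subseteq> {s. ?L s \<in> J}"
    using assms(2-5)
    by (auto simp: tensor_relations_def linear_rules(1,4)[OF L] lin_ext_basis[OF scale_vector_space]
        eq_mod_def diff_diff_eq)
  ultimately show ?thesis
    using free.span_minimal assms(6) unfolding tensor_ideal_def by blast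
qed

section \<open>Hopf algebras from generators\<close>

definition opposite :: "('k, 'a) kalg \<Rightarrow> ('k, 'a) kalg" where
  "opposite A = A\<lparr>alg_mult := \<lambda>u v. alg_mult A v u\<rparr>"

lemma opposite_simps [simp]:
  "alg_scale (opposite A) = alg_scale A" "alg_one (opposite A) = alg_one A"
  "alg_mult (opposite A) u v = alg_mult A v u"
  by (simp_all add: opposite_def)

lemma (in assoc_algebra) assoc_opposite: "assoc_algebra (opposite A)"
  by (intro assoc_algebra.intro assoc_algebra_axioms.intro)
    (simp_all add: scale_vector_space mult_assoc one_left one_right add_left add_right
      scale_mult_left scale_mult_right)

definition field_algebra :: "('k::field, 'k) kalg" where
  "field_algebra = \<lparr>alg_scale = (*), alg_mult = (*), alg_one = 1\<rparr>"

lemma field_algebra_simps [simp]: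
  "alg_scale field_algebra = (*)" "alg_one field_algebra = 1"
  "alg_mult field_algebra = (*)"
  by (simp_all add: field_algebra_def)

lemma assoc_field_algebra: "assoc_algebra field_algebra"
  by unfold_locales (simp_all add: algebra_simps)

text \<open>
  The winding map is the comultiplication followed by \<open>\<chi> \<otimes> id\<close>, and both are algebra
  homomorphisms. The bilinearity of \<open>(u, v) \<mapsto> \<chi>(u) v\<close> makes the second one well defined on
  tensors.
\<close>

lemma (in assoc_algebra) left_winding_hom:
  assumes comult: "hom_mod A (tensor_algebra A) (tensor_ideal A) \<Delta>"
    and char: "hom_mod A field_algebra {0} \<chi>"
  shows "hom_mod A A {0} (left_winding A \<Delta> \<chi>)"
proof -
  let ?W = "lin_ext (alg_scale A) (\<lambda>(u, v). alg_scale A (\<chi> u) v)"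
  note char_rules = linear_rules[OF hom_modD(1)[OF char, simplified]]
    and char_one = hom_modD(2)[OF char, simplified] and char_mult = hom_modD(3)[OF char, simplified]
  have W: "hom_mod (tensor_algebra A) A {0} ?W"
    unfolding tensor_algebra_def
    by (rule formal_lift[OF zero_ideal])
      (auto simp: char_one char_mult scale_mult_left scale_mult_right)
  have WI: "?W s \<in> {0}" if "s \<in> tensor_ideal A" for s
    using bilinear_kills_tensor_ideal[OF zero_ideal _ _ _ _ that,
        of "\<lambda>(v, w). alg_scale A (\<chi> v) w"]
    by (simp add: char_rules scale_left_distrib scale_right_distrib mult.commute)
  show ?thesis
    using hom_mod_comp[OF zero_ideal comult W WI] by (simp add: left_winding_def[abs_def])
qed

text \<open>
  The maps \<open>s \<mapsto> s \<otimes> w\<close> and \<open>s \<mapsto> w \<otimes> s\<close> from twofold to threefold tensors behave in the same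
  way. The parameter \<open>c w u v\<close> places \<open>w\<close> next to the pair \<open>(u, v)\<close>, so that the two sides of
  the coassociativity law are handled by one argument.
\<close>

locale tensor_insertion = assoc_algebra A
  for A :: "('k::field, 'a::ab_group_add) kalg" +
  fixes c :: "'a \<Rightarrow> 'a \<Rightarrow> 'a \<Rightarrow> 'a \<times> 'a \<times> 'a"
  assumes c_mult: "alg_mult (tensor3_algebra A) (Poly_Mapping.single (c w u v) 1) (Poly_Mapping.single (c w' u' v') 1)
      = Poly_Mapping.single (c (alg_mult A w w') (alg_mult A u u') (alg_mult A v v')) 1"
    and c_add:
      "eq_mod (tensor3_ideal A) (Poly_Mapping.single (c (w + w') u v) 1)
        (Poly_Mapping.single (c w u v) 1 + Poly_Mapping.single (c w' u v) 1)"
      "eq_mod (tensor3_ideal A) (Poly_Mapping.single (c w (u + u') v) 1)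
        (Poly_Mapping.single (c w u v) 1 + Poly_Mapping.single (c w u' v) 1)"
      "eq_mod (tensor3_ideal A) (Poly_Mapping.single (c w u (v + v')) 1)
        (Poly_Mapping.single (c w u v) 1 + Poly_Mapping.single (c w u v') 1)"
    and c_scale:
      "eq_mod (tensor3_ideal A) (Poly_Mapping.single (c (alg_scale A k w) u v) 1)
        (free_scale k (Poly_Mapping.single (c w u v) 1))"
      "eq_mod (tensor3_ideal A) (Poly_Mapping.single (c w (alg_scale A k u) v) 1)
        (free_scale k (Poly_Mapping.single (c w u v) 1))"
      "eq_mod (tensor3_ideal A) (Poly_Mapping.single (c w u (alg_scale A k v)) 1)
        (free_scale k (Poly_Mapping.single (c w u v) 1))"
begin

interpretation T3: algebra_with_ideal "tensor3_algebra A" "tensor3_ideal A"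
  by (rule tensor3_ideal)

definition ins :: "'a \<Rightarrow> ('k, 'a) tensor \<Rightarrow> ('k, 'a) tensor3" where
  "ins w = lin_ext free_scale (\<lambda>(u, v). Poly_Mapping.single (c w u v) 1)"

lemma ins_linear: "Vector_Spaces.linear free_scale free_scale (ins w)"
  unfolding ins_def by (rule lin_ext_linear[OF free_vector_space])

lemma ins_single: "ins w (Poly_Mapping.single (u, v) k) = Poly_Mapping.single (c w u v) k"
  by (simp add: ins_def lin_ext_free_single)

lemma ins_add: "eq_mod (tensor3_ideal A) (ins (w + w') s) (ins w s + ins w' s)"
  using T3.eq_lin_ext[of "\<lambda>(u, v). Poly_Mapping.single (c (w + w') u v) 1"
      "\<lambda>i. (\<lambda>(u, v). Poly_Mapping.single (c w u v) 1) i + (\<lambda>(u, v). Poly_Mapping.single (c w' u v) 1) i" s]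
  by (simp add: ins_def c_add lin_ext_fun_add[OF free_vector_space] case_prod_unfold)

lemma ins_scale: "eq_mod (tensor3_ideal A) (ins (alg_scale A k w) s) (free_scale k (ins w s))"
  using T3.eq_lin_ext[of "\<lambda>(u, v). Poly_Mapping.single (c (alg_scale A k w) u v) 1"
      "\<lambda>i. free_scale k ((\<lambda>(u, v). Poly_Mapping.single (c w u v) 1) i)" s]
    c_scale(1)
  by (simp add: ins_def lin_ext_fun_scale[OF free_vector_space] case_prod_unfold
      del: free_scale_single)

lemma ins_ideal: "s \<in> tensor_ideal A \<Longrightarrow> ins w s \<in> tensor3_ideal A"
  using bilinear_kills_tensor_ideal[OF tensor3_ideal,
      of "\<lambda>(u, v). Poly_Mapping.single (c w u v) 1" A s] c_add(2,3) c_scale(2,3)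
  by (simp add: ins_def)

lemma ins_eq: "eq_mod (tensor_ideal A) s t \<Longrightarrow> eq_mod (tensor3_ideal A) (ins w s) (ins w t)"
  using ins_ideal[of "s - t" w] by (simp add: eq_mod_def linear_rules[OF ins_linear])

lemma ins_mult:
  "ins (alg_mult A w w') (alg_mult (tensor_algebra A) s t)
     = alg_mult (tensor3_algebra A) (ins w s) (ins w' t)"
proof -
  note tm = tensor_mult_linear
  let ?w = "alg_mult A w w'"
  have 1: "ins ?w (alg_mult (tensor_algebra A) (Poly_Mapping.single i 1) (Poly_Mapping.single j 1))
     = alg_mult (tensor3_algebra A) (ins w (Poly_Mapping.single i 1)) (ins w' (Poly_Mapping.single j 1))"
    for i j
    by (cases i; cases j) (simp add: ins_single c_mult)
  have 2: "ins ?w (alg_mult (tensor_algebra A) (Poly_Mapping.single i 1) t)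
     = alg_mult (tensor3_algebra A) (ins w (Poly_Mapping.single i 1)) (ins w' t)" for i
    by (rule linear_free_eqI[OF linear_comp[OF tm(2) ins_linear]
          linear_comp[OF ins_linear tm(4)] 1])
  show ?thesis
    by (rule linear_free_eqI[OF linear_comp[OF tm(1) ins_linear]
          linear_comp[OF ins_linear tm(3)] 2])
qed

lemma ins_eq_mult:
  "eq_mod (tensor_ideal A) r (alg_mult (tensor_algebra A) s t) \<Longrightarrow>
    eq_mod (tensor3_ideal A) (ins (alg_mult A w w') r)
      (alg_mult (tensor3_algebra A) (ins w s) (ins w' t))"
  by (drule ins_eq[of _ _ "alg_mult A w w'"]) (simp add: ins_mult)

end

text \<open>
  The two alternatives for a generator describe an invertible group-like element and a
  \<open>(1,h)\<close>-primitive element with \<open>h\<close> group-like. The last two equations in each are the antipode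
  axioms at that generator.
\<close>

locale hopf_generators = assoc_algebra A
  for A :: "('k::field, 'a::ab_group_add) kalg" +
  fixes \<Delta> :: "'a \<Rightarrow> ('k, 'a) tensor" and \<epsilon> :: "'a \<Rightarrow> 'k" and S :: "'a \<Rightarrow> 'a"
    and X :: "'a set"
  assumes comult_hom: "hom_mod A (tensor_algebra A) (tensor_ideal A) \<Delta>"
    and comult_1: "\<Delta> (alg_one A) = ptensor (alg_one A) (alg_one A)"
    and counit_hom: "hom_mod A field_algebra {0} \<epsilon>"
    and antipode_hom: "hom_mod A (opposite A) {0} S"
    and gen: "generates A X"
    and generators: "u \<in> X \<Longrightarrow>
      (\<Delta> u = ptensor u u \<and> \<epsilon> u = 1 \<and> alg_mult A (S u) u = alg_one A \<and> alg_mult A u (S u) = alg_one A) \<or>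
      (\<exists>h. \<Delta> h = ptensor h h \<and> \<epsilon> h = 1 \<and> \<Delta> u = ptensor u (alg_one A) + ptensor h u \<and> \<epsilon> u = 0 \<and>
        S u + alg_mult A (S h) u = 0 \<and> u + alg_mult A h (S u) = 0)"
begin

interpretation T2: algebra_with_ideal "tensor_algebra A" "tensor_ideal A"
  by (rule tensor_ideal)
interpretation T3: algebra_with_ideal "tensor3_algebra A" "tensor3_ideal A"
  by (rule tensor3_ideal)

sublocale right: tensor_insertion A "\<lambda>w u v. (u, v, w)"
  by unfold_locales (simp_all add: tensor3_ideal_linear del: free_scale_single)
sublocale left: tensor_insertion A "\<lambda>w u v. (w, u, v)"
  by unfold_locales (simp_all add: tensor3_ideal_linear del: free_scale_single)

lemmas comult_linear = hom_modD(1)[OF comult_hom, simplified]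
  and comult_mult' = hom_modD(3)[OF comult_hom]
  and counit_rules = linear_rules[OF hom_modD(1)[OF counit_hom, simplified]]
  and counit_mult' = hom_modD(3)[OF counit_hom, simplified]
  and counit_1 = hom_modD(2)[OF counit_hom, simplified]
  and antipode_rules = linear_rules[OF hom_modD(1)[OF antipode_hom, simplified]]
  and antipode_mult = hom_modD(3)[OF antipode_hom, simplified]
  and antipode_1 = hom_modD(2)[OF antipode_hom, simplified]

lemmas comult_rules = linear_rules[OF comult_linear]

text \<open>
  Both composites \<open>(\<Delta> \<otimes> id) \<circ> \<Delta>\<close> and \<open>(id \<otimes> \<Delta>) \<circ> \<Delta>\<close> are homomorphisms into the threefold tensor
  product. On \<open>u\<close> group-like both give \<open>u \<otimes> u \<otimes> u\<close>, and on \<open>u\<close> primitive both give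
  \<open>u \<otimes> 1 \<otimes> 1 + h \<otimes> u \<otimes> 1 + h \<otimes> h \<otimes> u\<close>.
\<close>

lemma coassociativity:
  "eq_mod (tensor3_ideal A)
     (lin_ext free_scale (\<lambda>(v, w). right.ins w (\<Delta> v)) (\<Delta> u))
     (lin_ext free_scale (\<lambda>(v, w). left.ins v (\<Delta> w)) (\<Delta> u))"
proof -
  let ?P = "lin_ext free_scale (\<lambda>(v, w). right.ins w (\<Delta> v))"
  let ?Q = "lin_ext free_scale (\<lambda>(v, w). left.ins v (\<Delta> w))"
  let ?T2 = "tensor_algebra A" and ?T3 = "tensor3_algebra A" and ?I3 = "tensor3_ideal A"
  have P: "hom_mod ?T2 ?T3 ?I3 ?P"
    unfolding tensor_algebra_def
    by (subst tensor_algebra_simps(4)[symmetric], rule formal_lift[OF tensor3_ideal])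
      (auto simp: comult_1 right.ins_single intro: right.ins_eq_mult comult_mult')
  have Q: "hom_mod ?T2 ?T3 ?I3 ?Q"
    unfolding tensor_algebra_def
    by (subst tensor_algebra_simps(4)[symmetric], rule formal_lift[OF tensor3_ideal])
      (auto simp: comult_1 left.ins_single intro: left.ins_eq_mult comult_mult')
  have PI: "?P s \<in> ?I3" if "s \<in> tensor_ideal A" for s
    using bilinear_kills_tensor_ideal[OF tensor3_ideal _ _ _ _ that,
        of "\<lambda>(v, w). right.ins w (\<Delta> v)"]
    by (simp add: comult_rules linear_rules[OF right.ins_linear] right.ins_add right.ins_scale)
  have QI: "?Q s \<in> ?I3" if "s \<in> tensor_ideal A" for s
    using bilinear_kills_tensor_ideal[OF tensor3_ideal _ _ _ _ that,
        of "\<lambda>(v, w). left.ins v (\<Delta> w)"]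
    by (simp add: comult_rules linear_rules[OF left.ins_linear] left.ins_add left.ins_scale)
  show ?thesis
  proof (rule hom_mod_unique[OF tensor3_ideal hom_mod_comp[OF tensor3_ideal comult_hom P PI]
        hom_mod_comp[OF tensor3_ideal comult_hom Q QI] gen])
    fix u assume "u \<in> X"
    then have "?P (\<Delta> u) = ?Q (\<Delta> u)"
      using generators[of u]
      by (auto simp: lin_ext_free_rules lin_ext_free_single free.scale_one comult_1
          linear_rules[OF right.ins_linear] linear_rules[OF left.ins_linear] right.ins_single
          left.ins_single algebra_simps)
    then show "eq_mod ?I3 (?P (\<Delta> u)) (?Q (\<Delta> u))" by simp
  qed
qed

lemmas ext_rules = linear_rules[OF lin_ext_linear[OF scale_vector_space]]
lemmas ext_single = lin_ext_basis[OF scale_vector_space]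

lemma counit_left_law: "lin_ext (alg_scale A) (\<lambda>(v, w). alg_scale A (\<epsilon> v) w) (\<Delta> u) = u"
proof -
  have on_gen: "left_winding A \<Delta> \<epsilon> u = u" if "u \<in> X" for u
    using generators[OF that] by (auto simp: left_winding_def ext_rules ext_single counit_1)
  have "eq_mod {0} (left_winding A \<Delta> \<epsilon> u) u"
    by (rule hom_mod_unique[OF zero_ideal left_winding_hom[OF comult_hom counit_hom]
          hom_mod_id[OF assoc_algebra_axioms] gen]) (simp add: on_gen)
  then show ?thesis by (simp add: left_winding_def)
qed

lemma counit_right_law: "lin_ext (alg_scale A) (\<lambda>(v, w). alg_scale A (\<epsilon> w) v) (\<Delta> u) = u" (is "lin_ext _ ?f _ = _")
proof -
  let ?W = "lin_ext (alg_scale A) ?f"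
  have W: "hom_mod (tensor_algebra A) A {0} ?W"
    unfolding tensor_algebra_def
    by (rule formal_lift[OF zero_ideal])
      (auto simp: counit_1 counit_mult' scale_mult_left scale_mult_right)
  have WI: "?W s \<in> {0}" if "s \<in> tensor_ideal A" for s
    using bilinear_kills_tensor_ideal[OF zero_ideal _ _ _ _ that,
        of "\<lambda>(v, w). alg_scale A (\<epsilon> w) v"]
    by (simp add: counit_rules scale_left_distrib scale_right_distrib mult.commute)
  have on_gen: "?W (\<Delta> u) = u" if "u \<in> X" for u
    using generators[OF that] by (auto simp: ext_rules ext_single counit_1)
  have "eq_mod {0} (?W (\<Delta> u)) u"
    by (rule hom_mod_unique[OF zero_ideal hom_mod_comp[OF zero_ideal comult_hom W WI]
          hom_mod_id[OF assoc_algebra_axioms] gen]) (simp_all add: on_gen)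
  then show ?thesis by simp
qed

text \<open>
  The map \<open>u \<mapsto> S(u\<^sub>1) u\<^sub>2\<close> is not multiplicative, so uniqueness of homomorphisms does not apply. The
  elements satisfying the law nevertheless form a subalgebra, because \<open>S\<close> reverses products:
  \<open>S(u\<^sub>1v\<^sub>1) u\<^sub>2v\<^sub>2 = S(v\<^sub>1) (S(u\<^sub>1) u\<^sub>2) v\<^sub>2 = \<epsilon>(u) S(v\<^sub>1) v\<^sub>2\<close>.
\<close>

lemma antipode_left_law:
  "lin_ext (alg_scale A) (\<lambda>(v, w). alg_mult A (S v) w) (\<Delta> u) = alg_scale A (\<epsilon> u) (alg_one A)"
  (is "lin_ext _ ?f _ = _")
proof -
  let ?E = "lin_ext (alg_scale A) ?f"
  let ?G = "\<lambda>s. lin_ext (alg_scale A) (\<lambda>(v, w). alg_mult A (S v) (alg_mult A s w))"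
  note tm = tensor_mult_linear
  note EL = lin_ext_linear[OF scale_vector_space]
  have EI: "?E s \<in> {0}" if "s \<in> tensor_ideal A" for s
    using bilinear_kills_tensor_ideal[OF zero_ideal _ _ _ _ that,
        of "\<lambda>(v, w). alg_mult A (S v) w"]
    by (simp add: antipode_rules add_left add_right scale_mult_left scale_mult_right)
  have Gs: "Vector_Spaces.linear (alg_scale A) (alg_scale A) (\<lambda>s. ?G s t)" for t
    by (rule vector_spaces_linearI[OF scale_vector_space scale_vector_space])
      (simp_all add: add_left add_right scale_mult_left scale_mult_right case_prod_unfold
        lin_ext_fun_add[OF scale_vector_space] lin_ext_fun_scale[OF scale_vector_space])
  have 1: "?E (alg_mult (tensor_algebra A) (Poly_Mapping.single i 1) (Poly_Mapping.single j 1))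
      = ?G (?E (Poly_Mapping.single i 1)) (Poly_Mapping.single j 1)" for i j
    by (cases i; cases j) (simp add: ext_single antipode_mult mult_assoc)
  have 2: "?E (alg_mult (tensor_algebra A) (Poly_Mapping.single i 1) t)
      = ?G (?E (Poly_Mapping.single i 1)) t" for i t
    by (rule linear_free_eqI[OF linear_comp[OF tm(2) EL] EL 1])
  \<comment> \<open>both sides are bilinear, so the identity follows from its case of basis elements\<close>
  have twist: "?E (alg_mult (tensor_algebra A) s t) = ?G (?E s) t" for s t
    by (rule linear_free_eqI[OF linear_comp[OF tm(1) EL] linear_comp[OF EL Gs] 2])
  show ?thesis
    using gen
  proof (induction u rule: generates_induct)
    case (base u)
    then show ?case
      using generators[of u] by (auto simp: ext_rules ext_single antipode_1 one_left one_right)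
  next
    case one
    then show ?case by (simp add: comult_1 ext_single antipode_1 one_left counit_1)
  next
    case (mult u v)
    have "?E (\<Delta> (alg_mult A u v)) = ?E (alg_mult (tensor_algebra A) (\<Delta> u) (\<Delta> v))"
      using EI[of "\<Delta> (alg_mult A u v) - alg_mult (tensor_algebra A) (\<Delta> u) (\<Delta> v)"]
        comult_mult'[of u v] by (simp add: eq_mod_def ext_rules)
    also have "\<dots> = alg_scale A (\<epsilon> u) (?E (\<Delta> v))"
      unfolding twist mult(1)
      by (simp add: scale_mult_left scale_mult_right one_left case_prod_unfold
          lin_ext_fun_scale[OF scale_vector_space])
    finally show ?case using mult(2) by (simp add: counit_mult')
  qed (simp_all add: comult_rules ext_rules counit_rules scale_left_distrib)
qed

text \<open>
  The mirror image: here the inner factor is \<open>v\<^sub>1 S(v\<^sub>2)\<close>, in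
  \<open>u\<^sub>1v\<^sub>1 S(u\<^sub>2v\<^sub>2) = u\<^sub>1 (v\<^sub>1 S(v\<^sub>2)) S(u\<^sub>2)\<close>.
\<close>

lemma antipode_right_law:
  "lin_ext (alg_scale A) (\<lambda>(v, w). alg_mult A v (S w)) (\<Delta> u) = alg_scale A (\<epsilon> u) (alg_one A)"
  (is "lin_ext _ ?f _ = _")
proof -
  let ?E = "lin_ext (alg_scale A) ?f"
  let ?G = "\<lambda>t. lin_ext (alg_scale A) (\<lambda>(v, w). alg_mult A v (alg_mult A t (S w)))"
  note tm = tensor_mult_linear
  note EL = lin_ext_linear[OF scale_vector_space]
  have EI: "?E s \<in> {0}" if "s \<in> tensor_ideal A" for s
    using bilinear_kills_tensor_ideal[OF zero_ideal _ _ _ _ that,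
        of "\<lambda>(v, w). alg_mult A v (S w)"]
    by (simp add: antipode_rules add_left add_right scale_mult_left scale_mult_right)
  have Gs: "Vector_Spaces.linear (alg_scale A) (alg_scale A) (\<lambda>t. ?G t s)" for s
    by (rule vector_spaces_linearI[OF scale_vector_space scale_vector_space])
      (simp_all add: add_left add_right scale_mult_left scale_mult_right case_prod_unfold
        lin_ext_fun_add[OF scale_vector_space] lin_ext_fun_scale[OF scale_vector_space])
  have 1: "?E (alg_mult (tensor_algebra A) (Poly_Mapping.single i 1) (Poly_Mapping.single j 1))
      = ?G (?E (Poly_Mapping.single j 1)) (Poly_Mapping.single i 1)" for i j
    by (cases i; cases j) (simp add: ext_single antipode_mult mult_assoc)
  have 2: "?E (alg_mult (tensor_algebra A) s (Poly_Mapping.single j 1))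
      = ?G (?E (Poly_Mapping.single j 1)) s" for s j
    by (rule linear_free_eqI[OF linear_comp[OF tm(1) EL] EL 1])
  have twist: "?E (alg_mult (tensor_algebra A) s t) = ?G (?E t) s" for s t
    by (rule linear_free_eqI[OF linear_comp[OF tm(2) EL] linear_comp[OF EL Gs] 2])
  show ?thesis
    using gen
  proof (induction u rule: generates_induct)
    case (base u)
    then show ?case
      using generators[of u] by (auto simp: ext_rules ext_single antipode_1 one_left one_right)
  next
    case one
    then show ?case by (simp add: comult_1 ext_single antipode_1 one_left counit_1)
  next
    case (mult u v)
    have "?E (\<Delta> (alg_mult A u v)) = ?E (alg_mult (tensor_algebra A) (\<Delta> u) (\<Delta> v))"
      using EI[of "\<Delta> (alg_mult A u v) - alg_mult (tensor_algebra A) (\<Delta> u) (\<Delta> v)"]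
        comult_mult'[of u v] by (simp add: eq_mod_def ext_rules)
    also have "\<dots> = alg_scale A (\<epsilon> v) (?E (\<Delta> u))"
      unfolding twist mult(2)
      by (simp add: scale_mult_left scale_mult_right one_left case_prod_unfold
          lin_ext_fun_scale[OF scale_vector_space])
    finally show ?case using mult(1) by (simp add: counit_mult' mult.commute)
  qed (simp_all add: comult_rules ext_rules counit_rules scale_left_distrib)
qed

theorem hopf_algebra_from_generators: "hopf_algebra A \<Delta> \<epsilon> S"
proof (intro hopf_algebra.intro hopf_algebra_axioms.intro)
  show "assoc_algebra A" by (rule assoc_algebra_axioms)
  show "tensor_eq A (\<Delta> (alg_mult A u v)) (tensor_mult A (\<Delta> u) (\<Delta> v))" for u v
    using comult_mult' by (simp add: tensor_eq_iff tensor_algebra_mult)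
  show "tensor3_eq A
      (lin_ext free_scale (\<lambda>(v, w). lin_ext free_scale (\<lambda>(v1, v2). ptensor3 v1 v2 w) (\<Delta> v)) (\<Delta> u))
      (lin_ext free_scale (\<lambda>(v, w). lin_ext free_scale (\<lambda>(w1, w2). ptensor3 v w1 w2) (\<Delta> w)) (\<Delta> u))"
    for u
    using coassociativity[of u] by (simp add: tensor3_eq_iff right.ins_def left.ins_def)
  show "Vector_Spaces.linear (alg_scale A) (*) \<epsilon>" "Vector_Spaces.linear (alg_scale A) (alg_scale A) S"
    using hom_modD(1)[OF counit_hom] hom_modD(1)[OF antipode_hom] by simp_all
qed (simp_all add: tensor_eq_iff comult_rules comult_1 counit_1 counit_mult' counit_left_law
    counit_right_law antipode_left_law antipode_right_law)

end

section \<open>Characters, group algebras and skew derivations\<close>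

lemma character_rules:
  assumes "is_character \<chi>"
  shows "\<chi> (g + h) = \<chi> g * \<chi> h" "\<chi> g \<noteq> 0" "\<chi> 0 = 1" "\<chi> (- g) = inverse (\<chi> g)"
proof -
  show add: "\<chi> (g + h) = \<chi> g * \<chi> h" "\<chi> g \<noteq> 0" for g h
    using assms by (auto simp: is_character_def)
  show one: "\<chi> 0 = 1" using add(1)[of 0 0] add(2)[of 0] by simp
  have "\<chi> (- g) * \<chi> g = 1" using add(1)[of "- g" g] one by simp
  then show "\<chi> (- g) = inverse (\<chi> g)" using add(2)[of g] by (simp add: field_simps)
qed

lemma group_algebra_eq:
  "(group_algebra :: ('k::field, 'g::group_add \<Rightarrow>\<^sub>0 'k) kalg) = formal_algebra (+) 0"
proof -
  let ?F = "formal_algebra (+) 0 :: ('k, 'g \<Rightarrow>\<^sub>0 'k) kalg"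
  have l: "Vector_Spaces.linear free_scale free_scale (\<lambda>s :: 'g \<Rightarrow>\<^sub>0 'k. s * t)" for t
  proof (rule vector_spaces_linearI[OF free_vector_space free_vector_space])
    show "free_scale k s * t = free_scale k (s * t)" for k and s :: "'g \<Rightarrow>\<^sub>0 'k"
    proof -
      have "free_scale k u = Poly_Mapping.single 0 k * u" for u :: "'g \<Rightarrow>\<^sub>0 'k"
        by (induction u rule: poly_mapping_add_induct)
          (simp_all add: mult_single distrib_left free.scale_right_distrib)
      then show ?thesis by (simp add: mult.assoc)
    qed
  qed (simp add: distrib_right)
  have r: "Vector_Spaces.linear free_scale free_scale (\<lambda>t :: 'g \<Rightarrow>\<^sub>0 'k. s * t)" for s
  proof (rule vector_spaces_linearI[OF free_vector_space free_vector_space])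
    show "s * free_scale k t = free_scale k (s * t)" for k and t :: "'g \<Rightarrow>\<^sub>0 'k"
    proof -
      have "s * free_scale k (Poly_Mapping.single i l) = free_scale k (s * Poly_Mapping.single i l)" for i l
        by (induction s rule: poly_mapping_add_induct)
          (simp_all add: mult_single distrib_right free.scale_right_distrib mult.left_commute)
      then show ?thesis
        by (induction t rule: poly_mapping_add_induct)
          (simp_all add: distrib_left free.scale_right_distrib del: free_scale_single)
    qed
  qed (simp add: distrib_left)
  note lin = formal_mult_linear
  have "s * t = alg_mult ?F s t" for s t :: "'g \<Rightarrow>\<^sub>0 'k"
  proof -
    have 1: "Poly_Mapping.single g 1 * Poly_Mapping.single h 1
        = alg_mult ?F (Poly_Mapping.single g 1) (Poly_Mapping.single h 1)" for g h
      by (simp add: mult_single)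
    have 2: "Poly_Mapping.single g 1 * t = alg_mult ?F (Poly_Mapping.single g 1) t" for g
      by (rule linear_free_eqI[OF r lin(2) 1])
    show ?thesis by (rule linear_free_eqI[OF l lin(1) 2])
  qed
  then show ?thesis by (simp add: group_algebra_def formal_algebra_def fun_eq_iff)
qed

lemma assoc_group_algebra: "assoc_algebra group_algebra"
  unfolding group_algebra_eq by (rule assoc_formal_algebra) (simp_all add: add.assoc)

lemma group_elem_rules:
  "alg_mult group_algebra (group_elem g) (group_elem h) = group_elem (g + h)"
  "alg_one group_algebra = group_elem 0" "alg_scale group_algebra = free_scale"
  by (simp_all add: group_algebra_eq group_elem_def)

lemma generates_group_algebra:
  "generates group_algebra (range (group_elem :: 'g::group_add \<Rightarrow> 'g \<Rightarrow>\<^sub>0 'k::field))"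
proof -
  let ?S = "subalgebra_generated group_algebra (range (group_elem :: 'g \<Rightarrow> 'g \<Rightarrow>\<^sub>0 'k))"
  have single: "Poly_Mapping.single g k \<in> ?S" for g k
    using subalgebra_generated.scale[OF subalgebra_generated.base[OF rangeI], of group_algebra k group_elem g]
    by (simp add: group_elem_rules) (simp add: group_elem_def)
  have "p \<in> ?S" for p
    by (induction p rule: poly_mapping_add_induct)
      (use single[of 0 0] single subalgebra_generated.add in auto)
  then show ?thesis by auto
qed

lemma group_lift:
  assumes "algebra_with_ideal B I" "eq_mod I (\<phi> 0) (alg_one B)"
    and "\<And>g h. eq_mod I (\<phi> (g + h)) (alg_mult B (\<phi> g) (\<phi> h))"
  shows "hom_mod group_algebra B I (lin_ext (alg_scale B) \<phi>)"
  unfolding group_algebra_eq by (rule formal_lift) (use assms in auto)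

lemma group_lift_elem:
  assumes "assoc_algebra B"
  shows "lin_ext (alg_scale B) \<phi> (group_elem g) = \<phi> g"
proof -
  interpret assoc_algebra B by fact
  show ?thesis by (simp add: group_elem_def lin_ext_basis[OF scale_vector_space])
qed

lemma winding_group_hom:
  assumes "is_character \<chi>"
  shows "hom_mod group_algebra group_algebra {0} (winding_group \<chi>)"
proof -
  interpret G: assoc_algebra group_algebra by (rule assoc_group_algebra)
  interpret T2: algebra_with_ideal "tensor_algebra group_algebra" "tensor_ideal group_algebra"
    by (rule G.tensor_ideal)
  have "hom_mod group_algebra (tensor_algebra group_algebra) (tensor_ideal group_algebra) group_comult"
    unfolding group_comult_def
    by (subst tensor_algebra_simps(1)[of group_algebra, symmetric], rule group_lift[OF G.tensor_ideal])
      (simp_all add: group_elem_rules)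
  moreover have "hom_mod group_algebra field_algebra {0} (char_ext \<chi>)"
    unfolding char_ext_def
    by (subst field_algebra_simps(1)[symmetric],
        rule group_lift[OF assoc_algebra.zero_ideal[OF assoc_field_algebra]])
      (simp_all add: character_rules[OF assms])
  ultimately show ?thesis
    unfolding winding_group_def by (rule G.left_winding_hom)
qed

lemma winding_group_elem: "winding_group \<chi> (group_elem g) = free_scale (\<chi> g) (group_elem g)"
  by (simp add: group_elem_def winding_group_single)

text \<open>
  The triple \<open>(a, d, r)\<close> is the upper triangular matrix with diagonal entries \<open>a\<close>, \<open>r\<close> and
  off-diagonal entry \<open>d\<close>.
\<close>

definition triangular :: "('k, 'a::ab_group_add) kalg \<Rightarrow> ('k, 'a \<times> 'a \<times> 'a) kalg" where
  "triangular A =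
     \<lparr>alg_scale = (\<lambda>k (a, d, r). (alg_scale A k a, alg_scale A k d, alg_scale A k r)),
      alg_mult = (\<lambda>(a, d, r) (a', d', r').
        (alg_mult A a a', alg_mult A a d' + alg_mult A d r', alg_mult A r r')),
      alg_one = (alg_one A, 0, alg_one A)\<rparr>"

lemma triangular_simps [simp]:
  "alg_scale (triangular A) k (a, d, r) = (alg_scale A k a, alg_scale A k d, alg_scale A k r)"
  "alg_mult (triangular A) (a, d, r) (a', d', r')
     = (alg_mult A a a', alg_mult A a d' + alg_mult A d r', alg_mult A r r')"
  "alg_one (triangular A) = (alg_one A, 0, alg_one A)"
  by (simp_all add: triangular_def)

context assoc_algebra
begin

lemma assoc_triangular: "assoc_algebra (triangular A)"
  by unfold_locales
    (auto simp: mult_assoc one_left one_right add_left add_right scale_mult_left scale_mult_right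
      scale_left_distrib scale_right_distrib mult_zero_left mult_zero_right)

text \<open>
  If the diagonal of \<open>F(u)\<close> is \<open>(\<sigma>(u), u)\<close> on generators then it is so for all \<open>u\<close>, since both
  diagonal entries are homomorphisms. The off-diagonal entry of \<open>F(rs) = F(r) F(s)\<close> is then the
  twisted Leibniz rule.
\<close>

lemma skew_derivation_from_generators:
  assumes twist: "hom_mod A A {0} \<sigma>" and gen: "generates A X"
    and F: "hom_mod A (triangular A) {0} F"
    and on_gen: "\<And>u. u \<in> X \<Longrightarrow> \<exists>d. F u = (\<sigma> u, d, u)"
  obtains \<delta> where "skew_derivation A \<sigma> \<delta>" "\<And>u. F u = (\<sigma> u, \<delta> u, u)"
proof -
  note Fr = linear_rules[OF hom_modD(1)[OF F]] and F1 = hom_modD(2)[OF F, simplified]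
    and Fm = hom_modD(3)[OF F, simplified]
  let ?\<delta> = "\<lambda>u. fst (snd (F u))"
  have comp: "fst (alg_mult (triangular A) p q) = alg_mult A (fst p) (fst q)"
    "snd (snd (alg_mult (triangular A) p q)) = alg_mult A (snd (snd p)) (snd (snd q))"
    "fst (snd (alg_mult (triangular A) p q))
       = alg_mult A (fst p) (fst (snd q)) + alg_mult A (fst (snd p)) (snd (snd q))"
    "fst (alg_scale (triangular A) k p) = alg_scale A k (fst p)"
    "fst (snd (alg_scale (triangular A) k p)) = alg_scale A k (fst (snd p))"
    "snd (snd (alg_scale (triangular A) k p)) = alg_scale A k (snd (snd p))" for p q k
    by (cases p; cases q; simp)+
  have lin: "Vector_Spaces.linear (alg_scale A) (alg_scale A) f"
    if "f = (\<lambda>u. fst (F u)) \<or> f = ?\<delta> \<or> f = (\<lambda>u. snd (snd (F u)))" for f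
    by (rule vector_spaces_linearI[OF scale_vector_space scale_vector_space])
      (use that in \<open>auto simp: Fr comp\<close>)
  have diag: "hom_mod A A {0} (\<lambda>u. fst (F u))" "hom_mod A A {0} (\<lambda>u. snd (snd (F u)))"
    using lin by (auto simp: hom_mod_def F1 Fm comp)
  have "eq_mod {0} (fst (F u)) (\<sigma> u)" for u
    by (rule hom_mod_unique[OF zero_ideal diag(1) twist gen]) (auto dest: on_gen)
  moreover have "eq_mod {0} (snd (snd (F u))) u" for u
    by (rule hom_mod_unique[OF zero_ideal diag(2) hom_mod_id[OF assoc_algebra_axioms] gen])
      (auto dest: on_gen)
  ultimately have F_eq: "F u = (\<sigma> u, ?\<delta> u, u)" for u by (simp add: prod_eq_iff)
  have "?\<delta> (alg_mult A r s) = alg_mult A (\<sigma> r) (?\<delta> s) + alg_mult A (?\<delta> r) s" for r s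
    using comp(3)[of "F r" "F s"] F_eq by (metis Fm fst_conv snd_conv)
  then have "skew_derivation A \<sigma> ?\<delta>"
    using lin by (simp add: skew_derivation_def)
  then show ?thesis using that F_eq by blast
qed

end

section \<open>The Ore extension of the group algebra\<close>

context assoc_algebra
begin

interpretation T2: algebra_with_ideal "tensor_algebra A" "tensor_ideal A"
  by (rule tensor_ideal)

lemmas tensor_mult_rules =
  linear_rules(1,2,4)[OF tensor_mult_linear(1)] linear_rules(1,2,4)[OF tensor_mult_linear(2)]

text \<open>
  If \<open>u\<close> commutes with a group-like \<open>e\<close> up to the scalar \<open>k\<close>, so does its coproduct. This is the
  compatibility of the comultiplication with the relations \<open>xg = \<chi>(g)gx\<close> and \<open>yg = \<eta>(g)gy\<close>.
\<close>

lemma skew_primitive_scaled_commutation: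
  assumes "alg_mult A u e = alg_scale A k (alg_mult A e u)" "alg_mult A h e = alg_mult A e h"
  shows "eq_mod (tensor_ideal A)
    (alg_mult (tensor_algebra A) (ptensor u (alg_one A) + ptensor h u) (ptensor e e))
    (free_scale k (alg_mult (tensor_algebra A) (ptensor e e) (ptensor u (alg_one A) + ptensor h u)))"
  using T2.eq_add[OF tensor_ideal_linear(3)[of A k "alg_mult A e u" e]
      tensor_ideal_linear(4)[of A "alg_mult A e h" k "alg_mult A e u"]]
  by (simp add: tensor_mult_rules assms one_left one_right free.scale_right_distrib)

end

locale first_ore_data =
  fixes \<chi> :: "'g::group_add \<Rightarrow> 'k::field"
  assumes char: "is_character \<chi>"
begin

sublocale ore: ore_data group_algebra "winding_group \<chi>" "\<lambda>_. 0"
  rewrites first_ore: "ore_extension group_algebra (winding_group \<chi>) (\<lambda>_. 0) = first_ore \<chi>"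
proof -
  interpret G: assoc_algebra "group_algebra :: ('k, 'g \<Rightarrow>\<^sub>0 'k) kalg" by (rule assoc_group_algebra)
  show "ore_data group_algebra (winding_group \<chi>) (\<lambda>_. 0)"
    by (intro ore_data.intro ore_data_axioms.intro assoc_group_algebra winding_group_hom char)
      (auto simp: skew_derivation_def G.mult_zero_left G.mult_zero_right G.scale_vector_space
        intro!: vector_spaces_linearI)
qed (simp add: first_ore_def)

abbreviation "elem1 g \<equiv> ore_const (group_elem g) :: nat \<Rightarrow>\<^sub>0 'g \<Rightarrow>\<^sub>0 'k"
abbreviation "var1 \<equiv> ore_var group_algebra :: nat \<Rightarrow>\<^sub>0 'g \<Rightarrow>\<^sub>0 'k"

sublocale R: assoc_algebra "first_ore \<chi>"
  using ore.assoc_ore .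

lemma elem1_rules:
  "alg_one (first_ore \<chi>) = elem1 0"
  "alg_mult (first_ore \<chi>) (elem1 g) (elem1 h) = elem1 (g + h)"
  "alg_mult (first_ore \<chi>) var1 (elem1 g)
     = alg_scale (first_ore \<chi>) (\<chi> g) (alg_mult (first_ore \<chi>) (elem1 g) var1)"
proof -
  note c = hom_modD[OF ore.hom_ore_const, simplified]
  show "alg_one (first_ore \<chi>) = elem1 0"
    using c(2) by (simp add: group_elem_rules)
  show "alg_mult (first_ore \<chi>) (elem1 g) (elem1 h) = elem1 (g + h)"
    using c(3) by (simp add: group_elem_rules flip: c(3))
  show "alg_mult (first_ore \<chi>) var1 (elem1 g)
     = alg_scale (first_ore \<chi>) (\<chi> g) (alg_mult (first_ore \<chi>) (elem1 g) var1)"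
  proof -
    have "ore_const (winding_group \<chi> (group_elem g)) = alg_scale (first_ore \<chi>) (\<chi> g) (elem1 g)"
      using linear_rules(2)[OF hom_modD(1)[OF ore.hom_ore_const], of "\<chi> g" "group_elem g"]
      by (simp only: winding_group_elem group_elem_rules)
    then show ?thesis
      by (simp only: ore.ore_commutation R.scale_mult_left) (simp add: ore_const_def)
  qed
qed

lemma generates_first_ore: "generates (first_ore \<chi>) (range elem1 \<union> {var1})"
  using ore.generates_ore[OF generates_group_algebra] by (simp add: image_image)

text \<open>
  The universal property of \<open>K[G][x; \<tau>\<^sub>\<chi>]\<close>: it is presented by \<open>G\<close>, \<open>x\<close> and
  \<open>xg = \<chi>(g)gx\<close>. The homomorphism is given by its formula and not just asserted to exist, so that
  maps defined by explicit sums can be recognised as instances.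
\<close>

lemma first_ore_lift:
  assumes B: "algebra_with_ideal B I"
    and one: "\<phi> 0 = alg_one B"
    and mult: "\<And>g h. eq_mod I (\<phi> (g + h)) (alg_mult B (\<phi> g) (\<phi> h))"
    and comm: "\<And>g. eq_mod I (alg_mult B t (\<phi> g)) (alg_scale B (\<chi> g) (alg_mult B (\<phi> g) t))"
  defines "F \<equiv> ore_lift B (lin_ext (alg_scale B) \<phi>) t"
  shows "hom_mod (first_ore \<chi>) B I F" "F (elem1 g) = \<phi> g" "F var1 = t"
proof -
  interpret B: algebra_with_ideal B I by (rule B)
  let ?f = "lin_ext (alg_scale B) \<phi>"
  note f_elem = group_lift_elem[OF B.assoc_algebra_axioms, of \<phi>]
  have f: "hom_mod group_algebra B I ?f"
    by (rule group_lift[OF B]) (simp_all add: one mult)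
  interpret L: ore_lift_data group_algebra "winding_group \<chi>" "\<lambda>_. 0" B I ?f t "range group_elem"
    rewrites "ore_extension group_algebra (winding_group \<chi>) (\<lambda>_. 0) = first_ore \<chi>"
  proof -
    show "ore_lift_data group_algebra (winding_group \<chi>) (\<lambda>_. 0) B I ?f t (range group_elem)"
    proof (intro ore_lift_data.intro ore_lift_data_axioms.intro)
      fix r :: "'g \<Rightarrow>\<^sub>0 'k" assume "r \<in> range group_elem"
      then show "eq_mod I (alg_mult B t (?f r)) (alg_mult B (?f (winding_group \<chi> r)) t + ?f 0)"
        using comm linear_rules[OF hom_modD(1)[OF f]]
        by (auto simp: winding_group_elem f_elem group_elem_rules B.scale_mult_left)
    qed (fact ore.ore_data_axioms B f generates_group_algebra)+
  qed (rule first_ore)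
  show "hom_mod (first_ore \<chi>) B I F" unfolding F_def by (rule L.ore_lift_hom)
  show "F (elem1 g) = \<phi> g" unfolding F_def by (simp add: L.lift_const f_elem)
  show "F var1 = t" unfolding F_def by (rule L.lift_var) (simp add: group_elem_rules f_elem one)
qed

end

context first_ore_data
begin

declare ore.ore_one [simp del] ore.ore_scale [simp del]

text \<open>
  The explicit sum that defines this comultiplication is the lift of \<open>g \<mapsto> g \<otimes> g\<close> with
  \<open>x \<mapsto> x \<otimes> 1 + b \<otimes> x\<close>. Centrality of \<open>b\<close> is what makes \<open>b \<otimes> x\<close> commute with
  \<open>g \<otimes> g\<close> up to \<open>\<chi>(g)\<close>.
\<close>

lemma first_ore_comult_hom:
  assumes central: "b \<in> group_center"
  shows "hom_mod (first_ore \<chi>) (tensor_algebra (first_ore \<chi>)) (tensor_ideal (first_ore \<chi>))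
      (first_ore_comult \<chi> b)"
    and "first_ore_comult \<chi> b (elem1 g) = ptensor (elem1 g) (elem1 g)"
proof -
  let ?R = "first_ore \<chi>" and ?T = "tensor_algebra (first_ore \<chi>)"
  let ?x = "ptensor var1 (elem1 0) + ptensor (elem1 b) var1"
  let ?\<phi> = "\<lambda>g. ptensor (elem1 g) (elem1 g)"
  interpret T2: algebra_with_ideal ?T "tensor_ideal ?R" by (rule R.tensor_ideal)
  have comult_eq: "first_ore_comult \<chi> b = ore_lift ?T (lin_ext (alg_scale ?T) ?\<phi>) ?x"
    by (simp add: fun_eq_iff first_ore_comult_def Let_def ore_lift_def alg_pow_def tensor_algebra_mult
        elem1_rules(1) linear_lin_ext[OF tensor_mult_linear(1)[of ?R, unfolded tensor_algebra_mult]])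
  have commute: "alg_mult ?R (elem1 b) (elem1 g) = alg_mult ?R (elem1 g) (elem1 b)" for g
    using central by (simp add: elem1_rules group_center_def)
  have comm: "eq_mod (tensor_ideal ?R) (alg_mult ?T ?x (?\<phi> g)) (alg_scale ?T (\<chi> g) (alg_mult ?T (?\<phi> g) ?x))"
    for g
    using R.skew_primitive_scaled_commutation[OF elem1_rules(3) commute]
    by (simp add: elem1_rules(1))
  show "hom_mod ?R ?T (tensor_ideal ?R) (first_ore_comult \<chi> b)"
    "first_ore_comult \<chi> b (elem1 g) = ptensor (elem1 g) (elem1 g)"
    unfolding comult_eq
    by (rule first_ore_lift[OF R.tensor_ideal _ _ comm]; simp add: elem1_rules(1,2))+
qed

text \<open>
  Taking the constant coefficient is the lift with \<open>x \<mapsto> 0\<close>.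
\<close>

lemma constant_character_hom:
  assumes \<eta>: "is_character \<eta>"
  shows "hom_mod (first_ore \<chi>) field_algebra {0} (\<lambda>p. char_ext \<eta> (Poly_Mapping.lookup p 0))"
proof -
  have pow: "alg_pow (field_algebra :: ('k, 'k) kalg) 0 i = (if i = 0 then 1 else 0)" for i
    by (cases i) simp_all
  have "ore_lift field_algebra (lin_ext (alg_scale field_algebra) \<eta>) 0
      = (\<lambda>p. char_ext \<eta> (Poly_Mapping.lookup p 0))"
    by (simp add: fun_eq_iff ore_lift_def pow char_ext_def if_distrib in_keys_iff lin_ext_def cong: if_cong)
  then show ?thesis
    using first_ore_lift(1)[OF assoc_algebra.zero_ideal[OF assoc_field_algebra], of \<eta> 0]
    by (simp add: character_rules[OF \<eta>])
qed

lemma winding_first_ore_hom: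
  assumes "b \<in> group_center" "is_character \<eta>"
  shows "hom_mod (first_ore \<chi>) (first_ore \<chi>) {0} (winding_first_ore \<chi> b \<eta>)"
  unfolding winding_first_ore_def
  by (rule R.left_winding_hom[OF first_ore_comult_hom(1) constant_character_hom]) (use assms in auto)

lemma winding_first_ore_elem:
  assumes "b \<in> group_center"
  shows "winding_first_ore \<chi> b \<eta> (elem1 g) = alg_scale (first_ore \<chi>) (\<eta> g) (elem1 g)"
  by (simp add: winding_first_ore_def left_winding_def first_ore_comult_hom(2)[OF assms]
      lin_ext_basis[OF R.scale_vector_space])
    (simp add: ore_const_def group_elem_def char_ext_def lin_ext_single)

end

section \<open>The iterated Ore extension and its presentation\<close>

locale skew_pair = first_ore_data \<chi>
  for \<chi> :: "'g::group_add \<Rightarrow> 'k::field" +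
  fixes \<eta> :: "'g \<Rightarrow> 'k" and b c :: 'g and \<beta> :: 'k
  assumes char\<eta>: "is_character \<eta>"
    and central: "b \<in> group_center" "c \<in> group_center"
    and dual: "\<eta> b = inverse (\<chi> c)"
    and condition: "\<beta> = 0 \<or> c + b = 0 \<or> (\<forall>g. \<chi> g * \<eta> g = 1)"
begin

abbreviation "\<sigma> \<equiv> winding_first_ore \<chi> b \<eta>"
abbreviation "R \<equiv> first_ore \<chi>"

lemmas chars = character_rules[OF char] character_rules[OF char\<eta>]

lemma twist_var: "\<sigma> var1 = alg_scale R (\<eta> b) var1"
  using winding_first_ore_var[OF char char\<eta>, of b] by (simp add: group_elem_rules ore.ore_scale)

lemma center_commute: "b + g = g + b" "c + g = g + c" "(c + b) + g = g + (c + b)"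
proof -
  show b: "b + g = g + b" and c: "c + g = g + c" using central by (simp_all add: group_center_def)
  have "(c + b) + g = c + (g + b)" by (simp add: add.assoc b)
  also have "\<dots> = g + (c + b)" by (simp add: c flip: add.assoc)
  finally show "(c + b) + g = g + (c + b)" .
qed

text \<open>
  The triangular matrices of \<open>g\<close> and \<open>x\<close> satisfy the relations of the group algebra and
  \<open>xg = \<chi>(g)gx\<close>. With \<open>d = \<beta>(1 - cb)\<close>, the last relation demands
  \<open>d g = \<chi>(g)\<eta>(g) g d\<close>. As \<open>cb\<close> is central, \<open>d\<close> commutes with \<open>g\<close>, so this holds if
  \<open>d = 0\<close> or \<open>\<chi>\<eta> = 1\<close>.
\<close>

lemma skew_derivation_exists:
  obtains \<delta> where "skew_derivation R \<sigma> \<delta>" "\<And>g. \<delta> (elem1 g) = 0"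
    "\<delta> var1 = alg_scale R \<beta> (elem1 0 - elem1 (c + b))"
proof -
  interpret T: assoc_algebra "triangular R" by (rule R.assoc_triangular)
  let ?\<phi> = "\<lambda>g. (alg_scale R (\<eta> g) (elem1 g), 0, elem1 g)"
  define d where "d = alg_scale R \<beta> (elem1 0 - elem1 (c + b))"
  let ?t = "(alg_scale R (\<eta> b) var1, d, var1)"
  let ?F = "ore_lift (triangular R) (lin_ext (alg_scale (triangular R)) ?\<phi>) ?t"
  note R_rules = R.scale_mult_left R.scale_mult_right R.mult_zero_left R.mult_zero_right
    R.mult_diff_left R.mult_diff_right R.one_left R.one_right
  have d_comm: "alg_mult R d (elem1 g) = alg_scale R (\<chi> g * \<eta> g) (alg_mult R (elem1 g) d)" for g
  proof -
    have "alg_mult R d (elem1 g) = alg_mult R (elem1 g) d"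
      by (simp only: d_def R_rules elem1_rules(2) center_commute(3)[of g] add_0_left add_0_right)
    moreover have "d = 0 \<or> \<chi> g * \<eta> g = 1"
      using condition by (auto simp: d_def)
    ultimately show ?thesis by (metis R.mult_zero_left R.mult_zero_right R.scale_zero_right R.scale_one)
  qed
  have lift: "hom_mod R (triangular R) {0} ?F" "?F (elem1 g) = ?\<phi> g" "?F var1 = ?t" for g
  proof -
    have one: "?\<phi> 0 = alg_one (triangular R)"
      by (simp only: triangular_simps elem1_rules chars R.scale_one)
    have mult: "eq_mod {0} (?\<phi> (g + h)) (alg_mult (triangular R) (?\<phi> g) (?\<phi> h))" for g h
      by (simp only: triangular_simps eq_mod_zero elem1_rules R_rules chars R.scale_scale) simp
    have comm: "eq_mod {0} (alg_mult (triangular R) ?t (?\<phi> g))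
        (alg_scale (triangular R) (\<chi> g) (alg_mult (triangular R) (?\<phi> g) ?t))" for g
      by (simp add: elem1_rules(3) d_comm R.scale_mult_left R.scale_mult_right R.mult_zero_left
          R.mult_zero_right mult_ac)
    show "hom_mod R (triangular R) {0} ?F" "?F (elem1 g) = ?\<phi> g" "?F var1 = ?t"
      by (rule first_ore_lift[OF T.zero_ideal one mult comm])+
  qed
  have on_gen: "\<exists>d. ?F u = (\<sigma> u, d, u)" if "u \<in> range elem1 \<union> {var1}" for u
    using that by (auto simp: lift twist_var winding_first_ore_elem[OF central(1)])
  obtain \<delta> where \<delta>: "skew_derivation R \<sigma> \<delta>" "\<And>u. ?F u = (\<sigma> u, \<delta> u, u)"
    using R.skew_derivation_from_generators[OF winding_first_ore_hom[OF central(1) char\<eta>]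
        generates_first_ore lift(1) on_gen] by blast
  show ?thesis
  proof (rule that[OF \<delta>(1)])
    show "\<delta> (elem1 g) = 0" for g using \<delta>(2)[of "elem1 g"] by (simp add: lift(2))
    show "\<delta> var1 = alg_scale R \<beta> (elem1 0 - elem1 (c + b))"
      using \<delta>(2)[of var1] by (simp add: lift(3) d_def[symmetric])
  qed
qed

end

context assoc_algebra
begin

interpretation T2: algebra_with_ideal "tensor_algebra A" "tensor_ideal A"
  by (rule tensor_ideal)

text \<open>
  Let \<open>u\<close> be \<open>(1,h)\<close>-primitive and \<open>v\<close> be \<open>(1,k)\<close>-primitive. In
  \<open>\<Delta>(v)\<Delta>(u) - q \<Delta>(u)\<Delta>(v)\<close> the mixed terms cancel by the first two assumptions. What is left is
  \<open>\<beta>(1 - kh) \<otimes> 1 + kh \<otimes> \<beta>(1 - kh)\<close>, which telescopes to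
  \<open>\<beta>(1 \<otimes> 1 - kh \<otimes> kh)\<close>. So the coproducts satisfy the relation of \<open>u\<close> and \<open>v\<close>.
\<close>

lemma skew_primitive_q_commutation:
  fixes q \<beta> :: 'k
  assumes vh: "alg_mult A v h = alg_scale A q (alg_mult A h v)"
    and ku: "alg_mult A k u = alg_scale A q (alg_mult A u k)"
    and hk: "alg_mult A h k = alg_mult A k h"
    and vu: "alg_mult A v u = alg_scale A q (alg_mult A u v)
      + alg_scale A \<beta> (alg_one A - alg_mult A k h)"
  shows "eq_mod (tensor_ideal A)
    (alg_mult (tensor_algebra A) (ptensor v (alg_one A) + ptensor k v) (ptensor u (alg_one A) + ptensor h u))
    (free_scale q
      (alg_mult (tensor_algebra A) (ptensor u (alg_one A) + ptensor h u) (ptensor v (alg_one A) + ptensor k v))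
     + free_scale \<beta> (ptensor (alg_one A) (alg_one A) - ptensor (alg_mult A k h) (alg_mult A k h)))"
proof -
  let ?I = "tensor_ideal A" and ?m = "alg_mult A" and ?i = "alg_one A"
  have L: "eq_mod ?I (ptensor (alg_scale A q w + alg_scale A \<beta> (z - z')) w')
      (free_scale q (ptensor w w') + free_scale \<beta> (ptensor z w' - ptensor z' w'))" for w w' z z'
  proof -
    have "eq_mod ?I (ptensor (z - z') w') (ptensor z w' - ptensor z' w')"
      using T2.eq_diff[OF T2.eq_sym[OF tensor_ideal_linear(1)[of A "z - z'" z' w']] T2.eq_refl[of "ptensor z' w'"]]
      by (simp add: T2.eq_sym)
    from T2.eq_trans[OF tensor_ideal_linear(3) T2.eq_scale[OF this, simplified tensor_algebra_simps]]
    show ?thesis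
      by (intro T2.eq_trans[OF tensor_ideal_linear(1)] T2.eq_add tensor_ideal_linear(3)) simp
  qed
  have R: "eq_mod ?I (ptensor w' (alg_scale A q w + alg_scale A \<beta> (z - z')))
      (free_scale q (ptensor w' w) + free_scale \<beta> (ptensor w' z - ptensor w' z'))" for w w' z z'
  proof -
    have "eq_mod ?I (ptensor w' (z - z')) (ptensor w' z - ptensor w' z')"
      using T2.eq_diff[OF T2.eq_sym[OF tensor_ideal_linear(2)[of A w' "z - z'" z']] T2.eq_refl[of "ptensor w' z'"]]
      by (simp add: T2.eq_sym)
    from T2.eq_trans[OF tensor_ideal_linear(4) T2.eq_scale[OF this, simplified tensor_algebra_simps]]
    show ?thesis
      by (intro T2.eq_trans[OF tensor_ideal_linear(2)] T2.eq_add tensor_ideal_linear(4)) simp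
  qed
  let ?e = "?m k h"
  have left: "alg_mult (tensor_algebra A) (ptensor v ?i + ptensor k v) (ptensor u ?i + ptensor h u)
     = (ptensor (alg_scale A q (?m u v) + alg_scale A \<beta> (?i - ?e)) ?i
        + ptensor (alg_scale A q (?m h v)) u)
       + (ptensor (alg_scale A q (?m u k)) v
        + ptensor ?e (alg_scale A q (?m u v) + alg_scale A \<beta> (?i - ?e)))"
    by (simp add: tensor_mult_rules one_left one_right vh ku vu)
  have expand: "eq_mod ?I ((ptensor (alg_scale A q (?m u v) + alg_scale A \<beta> (?i - ?e)) ?i
        + ptensor (alg_scale A q (?m h v)) u)
       + (ptensor (alg_scale A q (?m u k)) v
        + ptensor ?e (alg_scale A q (?m u v) + alg_scale A \<beta> (?i - ?e))))
      ((free_scale q (ptensor (?m u v) ?i) + free_scale \<beta> (ptensor ?i ?i - ptensor ?e ?i)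
        + free_scale q (ptensor (?m h v) u))
       + (free_scale q (ptensor (?m u k) v)
        + (free_scale q (ptensor ?e (?m u v)) + free_scale \<beta> (ptensor ?e ?i - ptensor ?e ?e))))"
    by (intro T2.eq_add L R tensor_ideal_linear(3))
  have right: "((free_scale q (ptensor (?m u v) ?i) + free_scale \<beta> (ptensor ?i ?i - ptensor ?e ?i)
        + free_scale q (ptensor (?m h v) u))
       + (free_scale q (ptensor (?m u k) v)
        + (free_scale q (ptensor ?e (?m u v)) + free_scale \<beta> (ptensor ?e ?i - ptensor ?e ?e)))) = free_scale q
      (alg_mult (tensor_algebra A) (ptensor u ?i + ptensor h u) (ptensor v ?i + ptensor k v))
     + free_scale \<beta> (ptensor ?i ?i - ptensor ?e ?e)"
  proof -
    have "alg_mult (tensor_algebra A) (ptensor u ?i + ptensor h u) (ptensor v ?i + ptensor k v)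
      = ptensor (?m u v) ?i + ptensor (?m u k) v + (ptensor (?m h v) u + ptensor ?e (?m u v))"
      by (simp add: tensor_mult_rules one_left one_right hk)
    then show ?thesis
      by (simp only: free.scale_right_distrib free.scale_right_diff_distrib) (simp only: algebra_simps)
  qed
  show ?thesis using expand unfolding left right .
qed

end

locale skew_pair_derivation = skew_pair \<chi> \<eta> b c \<beta>
  for \<chi> \<eta> :: "'g::group_add \<Rightarrow> 'k::field" and b c :: 'g and \<beta> :: 'k +
  fixes \<delta> :: "(nat \<Rightarrow>\<^sub>0 'g \<Rightarrow>\<^sub>0 'k) \<Rightarrow> (nat \<Rightarrow>\<^sub>0 'g \<Rightarrow>\<^sub>0 'k)"
  assumes derivation: "skew_derivation (first_ore \<chi>) (winding_first_ore \<chi> b \<eta>) \<delta>"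
    and derivation_elem: "\<delta> (ore_const (group_elem g)) = 0"
    and derivation_var: "\<delta> (ore_var group_algebra) = alg_scale (first_ore \<chi>) \<beta>
      (ore_const (group_elem 0) - ore_const (group_elem (c + b)))"
begin

abbreviation "H \<equiv> second_ore \<chi> \<eta> b \<delta>"

sublocale ore2: ore_data R \<sigma> \<delta>
  rewrites second_ore: "ore_extension R \<sigma> \<delta> = H"
proof -
  show "ore_data R \<sigma> \<delta>"
    by (intro ore_data.intro ore_data_axioms.intro R.assoc_algebra_axioms
        winding_first_ore_hom central char\<eta> derivation)
qed (simp add: second_ore_def)

declare ore2.ore_one [simp del] ore2.ore_scale [simp del]

sublocale H: assoc_algebra H
  using ore2.assoc_ore .

abbreviation "E g \<equiv> ore_const (elem1 g)"
abbreviation "X \<equiv> ore_const var1 :: nat \<Rightarrow>\<^sub>0 nat \<Rightarrow>\<^sub>0 'g \<Rightarrow>\<^sub>0 'k"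
abbreviation "Y \<equiv> ore_var R"
abbreviation "m \<equiv> alg_mult H"
abbreviation "s \<equiv> alg_scale H"

lemmas const_rules = linear_rules[OF hom_modD(1)[OF ore2.hom_ore_const]]
  and const_one = hom_modD(2)[OF ore2.hom_ore_const, simplified]
  and const_mult = hom_modD(3)[OF ore2.hom_ore_const, simplified]

lemma relations:
  "alg_one H = E 0"
  "m (E g) (E h) = E (g + h)"
  "m X (E g) = s (\<chi> g) (m (E g) X)"
  "m Y (E g) = s (\<eta> g) (m (E g) Y)"
  "m Y X = s (\<eta> b) (m X Y) + s \<beta> (alg_one H - E (c + b))"
  by (simp_all only: const_one[symmetric] const_mult[symmetric] elem1_rules const_rules
      ore2.ore_commutation winding_first_ore_elem[OF central(1)] twist_var derivation_elem
      derivation_var H.scale_mult_left add_0_right)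

lemma generates_H: "generates H (range E \<union> {X, Y})"
proof -
  have "range E \<union> {X, Y} = ore_const ` (range elem1 \<union> {var1}) \<union> {Y}"
    by (auto simp: image_image image_Un)
  then show ?thesis using ore2.generates_ore[OF generates_first_ore] by simp
qed

text \<open>
  \<open>H\<close> is presented by the group \<open>G\<close> and the elements \<open>X\<close>, \<open>Y\<close> with the relations above. The
  lift for the second Ore extension only needs its commutation rule on the generators of the first,
  where it is one of the relations.
\<close>

lemma presentation_lift:
  assumes B: "algebra_with_ideal B I"
    and one: "\<phi> 0 = alg_one B"
    and mult: "\<And>g h. eq_mod I (\<phi> (g + h)) (alg_mult B (\<phi> g) (\<phi> h))"
    and t: "\<And>g. eq_mod I (alg_mult B t (\<phi> g)) (alg_scale B (\<chi> g) (alg_mult B (\<phi> g) t))"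
    and u: "\<And>g. eq_mod I (alg_mult B u (\<phi> g)) (alg_scale B (\<eta> g) (alg_mult B (\<phi> g) u))"
    and ut: "eq_mod I (alg_mult B u t)
      (alg_scale B (\<eta> b) (alg_mult B t u) + alg_scale B \<beta> (alg_one B - \<phi> (c + b)))"
  obtains F where "hom_mod H B I F" "\<And>g. F (E g) = \<phi> g" "F X = t" "F Y = u"
proof -
  interpret B: algebra_with_ideal B I by (rule B)
  let ?f = "ore_lift B (lin_ext (alg_scale B) \<phi>) t"
  note f = first_ore_lift[OF B one mult t]
  note f_rules = linear_rules[OF hom_modD(1)[OF f(1)]]
  interpret L: ore_lift_data R \<sigma> \<delta> B I ?f u "range elem1 \<union> {var1}"
    rewrites "ore_extension R \<sigma> \<delta> = H"
  proof -
    show "ore_lift_data R \<sigma> \<delta> B I ?f u (range elem1 \<union> {var1})"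
    proof (intro ore_lift_data.intro ore_lift_data_axioms.intro)
      fix r assume "r \<in> range elem1 \<union> {var1}"
      then show "eq_mod I (alg_mult B u (?f r)) (alg_mult B (?f (\<sigma> r)) u + ?f (\<delta> r))"
        using u ut by (auto simp: winding_first_ore_elem[OF central(1)] twist_var derivation_elem
            derivation_var f f_rules B.scale_mult_left one)
    qed (fact ore2.ore_data_axioms B f(1) generates_first_ore)+
  qed (rule second_ore)
  show ?thesis
    by (rule that[OF L.ore_lift_hom]) (simp_all add: L.lift_const L.lift_var f elem1_rules(1) one)
qed

lemma dual_product: "\<eta> b * \<chi> c = 1"
  using dual chars(2) by simp

section \<open>The Hopf algebra structure\<close>

lemma comultiplication_exists:
  obtains \<Delta> where "hom_mod H (tensor_algebra H) (tensor_ideal H) \<Delta>"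
    "\<And>g. \<Delta> (E g) = ptensor (E g) (E g)"
    "\<Delta> X = ptensor X (alg_one H) + ptensor (E b) X"
    "\<Delta> Y = ptensor Y (alg_one H) + ptensor (E c) Y"
proof (rule presentation_lift[OF H.tensor_ideal])
  let ?\<phi> = "\<lambda>g. ptensor (E g) (E g)"
  have "m (E b) (E g) = m (E g) (E b)" "m (E c) (E g) = m (E g) (E c)" for g
    by (simp_all only: relations(2) center_commute(1,2)[of g])
  note comm = this
  show "?\<phi> 0 = alg_one (tensor_algebra H)" by (simp add: relations(1))
  show "eq_mod (tensor_ideal H) (?\<phi> (g + h)) (alg_mult (tensor_algebra H) (?\<phi> g) (?\<phi> h))" for g h
    by (simp add: relations(2) algebra_with_ideal.eq_refl[OF H.tensor_ideal])
  show "eq_mod (tensor_ideal H)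
      (alg_mult (tensor_algebra H) (ptensor X (alg_one H) + ptensor (E b) X) (?\<phi> g))
      (alg_scale (tensor_algebra H) (\<chi> g)
        (alg_mult (tensor_algebra H) (?\<phi> g) (ptensor X (alg_one H) + ptensor (E b) X)))" for g
    using H.skew_primitive_scaled_commutation[OF relations(3) comm(1)] by simp
  show "eq_mod (tensor_ideal H)
      (alg_mult (tensor_algebra H) (ptensor Y (alg_one H) + ptensor (E c) Y) (?\<phi> g))
      (alg_scale (tensor_algebra H) (\<eta> g)
        (alg_mult (tensor_algebra H) (?\<phi> g) (ptensor Y (alg_one H) + ptensor (E c) Y)))" for g
    using H.skew_primitive_scaled_commutation[OF relations(4) comm(2)] by simp
  have "m (E c) X = s (\<eta> b) (m X (E c))"
    by (simp add: relations(3) dual_product)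
  then show "eq_mod (tensor_ideal H)
      (alg_mult (tensor_algebra H) (ptensor Y (alg_one H) + ptensor (E c) Y)
        (ptensor X (alg_one H) + ptensor (E b) X))
      (alg_scale (tensor_algebra H) (\<eta> b)
        (alg_mult (tensor_algebra H) (ptensor X (alg_one H) + ptensor (E b) X)
          (ptensor Y (alg_one H) + ptensor (E c) Y))
       + alg_scale (tensor_algebra H) \<beta> (alg_one (tensor_algebra H) - ?\<phi> (c + b)))"
    using H.skew_primitive_q_commutation[where u = X and k = "E c" and \<beta> = \<beta>,
        OF relations(4) _ comm(1)]
    by (simp add: relations(2,5))
qed (rule that)

lemma counit_exists:
  obtains \<epsilon> where "hom_mod H field_algebra {0} \<epsilon>" "\<And>g. \<epsilon> (E g) = 1" "\<epsilon> X = 0" "\<epsilon> Y = 0"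
  by (rule presentation_lift[OF assoc_algebra.zero_ideal[OF assoc_field_algebra],
        of "\<lambda>_. 1" 0 0]) (use that in simp_all)

text \<open>
  In the opposite algebra the relation for \<open>YX\<close> becomes \<open>S(X)S(Y) = q S(Y)S(X) + \<beta>(1 - (cb)\<^sup>-\<^sup>1)\<close>
  in \<open>H\<close>. Moving group elements to the left, \<open>S(X)S(Y) = q (cb)\<^sup>-\<^sup>1 XY\<close> and
  \<open>q S(Y)S(X) = (cb)\<^sup>-\<^sup>1 YX = q (cb)\<^sup>-\<^sup>1 XY + \<beta>((cb)\<^sup>-\<^sup>1 - 1)\<close>; the scalars are
  \<open>\<chi>(c\<^sup>-\<^sup>1) = q\<close> and \<open>q \<eta>(b\<^sup>-\<^sup>1) = 1\<close>.
\<close>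

lemma antipode_exists:
  obtains S where "hom_mod H (opposite H) {0} S" "\<And>g. S (E g) = E (- g)"
    "S X = - m (E (- b)) X" "S Y = - m (E (- c)) Y"
proof (rule presentation_lift[OF assoc_algebra.zero_ideal[OF H.assoc_opposite],
      of "\<lambda>g. E (- g)" "- m (E (- b)) X" "- m (E (- c)) Y"])
  have neg: "m (- u) v = - m u v" "m u (- v) = - m u v" for u v
    using H.mult_diff_left[of 0 u v] H.mult_diff_right[of u 0 v]
    by (simp_all add: H.mult_zero_left H.mult_zero_right)
  have assoc: "m (E g) (m (E h) w) = m (E (g + h)) w" "m X (m (E g) w) = s (\<chi> g) (m (E g) (m X w))"
    "m Y (m (E g) w) = s (\<eta> g) (m (E g) (m Y w))" for g h w
    by (simp_all add: relations H.scale_mult_left flip: H.mult_assoc)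
  note normalize = neg assoc relations(2-4) H.mult_assoc H.scale_mult_left H.scale_mult_right
    H.scale_minus_right
  have swap: "- g + - b = - b + - g" "- g + - c = - c + - g" for g
    using center_commute(1,2)[of g] by (metis minus_add)+
  show "E (- 0) = alg_one (opposite H)" by (simp add: relations(1))
  show "eq_mod {0} (E (- (g + h))) (alg_mult (opposite H) (E (- g)) (E (- h)))" for g h
    by (simp add: relations(2) minus_add)
  show "eq_mod {0} (alg_mult (opposite H) (- m (E (- b)) X) (E (- g)))
      (alg_scale (opposite H) (\<chi> g) (alg_mult (opposite H) (E (- g)) (- m (E (- b)) X)))" for g
    using swap(1)[of g] by (simp add: normalize chars)
  show "eq_mod {0} (alg_mult (opposite H) (- m (E (- c)) Y) (E (- g)))
      (alg_scale (opposite H) (\<eta> g) (alg_mult (opposite H) (E (- g)) (- m (E (- c)) Y)))" for g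
    using swap(2)[of g] by (simp add: normalize chars)
  have "m (- m (E (- b)) X) (- m (E (- c)) Y) = s (\<eta> b) (m (E (- (c + b))) (m X Y))"
    by (simp add: normalize chars dual minus_add)
  moreover have "s (\<eta> b) (m (- m (E (- c)) Y) (- m (E (- b)) X)) = m (E (- (c + b))) (m Y X)"
    using swap(2)[of b] by (simp add: normalize chars minus_add)
  moreover have "m (E (- (c + b))) (m Y X) = s (\<eta> b) (m (E (- (c + b))) (m X Y))
      - s \<beta> (alg_one H - E (- (c + b)))"
    by (simp add: relations(1,2,5) H.add_right H.scale_mult_right H.mult_diff_right H.scale_right_diff_distrib)
  ultimately show "eq_mod {0} (alg_mult (opposite H) (- m (E (- c)) Y) (- m (E (- b)) X))
      (alg_scale (opposite H) (\<eta> b) (alg_mult (opposite H) (- m (E (- b)) X) (- m (E (- c)) Y))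
       + alg_scale (opposite H) \<beta> (alg_one (opposite H) - E (- (c + b))))"
    by simp
qed (rule that)

theorem hopf_structure_exists:
  obtains \<Delta> \<epsilon> S where "hopf_algebra H \<Delta> \<epsilon> S"
    "\<And>g. group_like H \<Delta> (E g)"
    "skew_primitive H \<Delta> (alg_one H) (E b) X"
    "skew_primitive H \<Delta> (alg_one H) (E c) Y"
proof -
  obtain \<Delta> where \<Delta>: "hom_mod H (tensor_algebra H) (tensor_ideal H) \<Delta>"
    "\<And>g. \<Delta> (E g) = ptensor (E g) (E g)"
    "\<Delta> X = ptensor X (alg_one H) + ptensor (E b) X"
    "\<Delta> Y = ptensor Y (alg_one H) + ptensor (E c) Y"
    by (rule comultiplication_exists) (rule that)
  obtain \<epsilon> where \<epsilon>: "hom_mod H field_algebra {0} \<epsilon>" "\<And>g. \<epsilon> (E g) = 1" "\<epsilon> X = 0" "\<epsilon> Y = 0"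
    by (rule counit_exists) (rule that)
  obtain S where S: "hom_mod H (opposite H) {0} S" "\<And>g. S (E g) = E (- g)"
    "S X = - m (E (- b)) X" "S Y = - m (E (- c)) Y"
    by (rule antipode_exists) (rule that)
  have neg: "m u (- v) = - m u v" for u v
    using H.mult_diff_right[of u 0 v] by (simp add: H.mult_zero_right)
  have cancel: "m (E g) (m (E (- g)) w) = w" for g w
    using H.one_left by (simp add: relations(1,2) flip: H.mult_assoc)
  interpret G: hopf_generators H \<Delta> \<epsilon> S "range E \<union> {X, Y}"
  proof
    show "\<Delta> (alg_one H) = ptensor (alg_one H) (alg_one H)" by (simp add: relations(1) \<Delta>)
    fix u assume "u \<in> range E \<union> {X, Y}"
    then consider g where "u = E g" | "u = X" | "u = Y" by auto
    then show "(\<Delta> u = ptensor u u \<and> \<epsilon> u = 1 \<and> m (S u) u = alg_one H \<and> m u (S u) = alg_one H) \<or>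
      (\<exists>h. \<Delta> h = ptensor h h \<and> \<epsilon> h = 1 \<and> \<Delta> u = ptensor u (alg_one H) + ptensor h u \<and> \<epsilon> u = 0 \<and>
        S u + m (S h) u = 0 \<and> u + m h (S u) = 0)"
    proof cases
      case 1
      then show ?thesis by (simp add: \<Delta> \<epsilon> S relations(1,2))
    next
      case 2
      then show ?thesis by (intro disjI2 exI[of _ "E b"]) (simp add: \<Delta> \<epsilon> S neg cancel)
    next
      case 3
      then show ?thesis by (intro disjI2 exI[of _ "E c"]) (simp add: \<Delta> \<epsilon> S neg cancel)
    qed
  qed (fact \<Delta>(1) \<epsilon>(1) S(1) generates_H)+
  have refl: "eq_mod (tensor_ideal H) t t" for t
    by (rule algebra_with_ideal.eq_refl[OF H.tensor_ideal])
  have "E g \<noteq> 0" for g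
    by (simp add: ore_const_def group_elem_def single_eq_zero_iff)
  then show ?thesis
    using that[OF G.hopf_algebra_from_generators] refl
    by (simp add: group_like_def skew_primitive_def tensor_eq_iff \<Delta>)
qed

end

theorem theorem2p1:
  fixes \<chi> \<eta> :: "'g::group_add \<Rightarrow> 'k::{alg_closed_field, field_char_0}"
    and b c :: 'g and \<beta> :: 'k
  assumes "is_character \<chi>" and "is_character \<eta>"
    and "b \<in> group_center" and "c \<in> group_center"
    and "\<eta> b = inverse (\<chi> c)"
    and "\<beta> = 0 \<or> c + b = 0 \<or> (\<forall>g. \<chi> g * \<eta> g = 1)"
  shows "\<exists>\<delta>. skew_derivation (first_ore \<chi>) (winding_first_ore \<chi> b \<eta>) \<delta> \<and>
    (let H = second_ore \<chi> \<eta> b \<delta>;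
         elem = (\<lambda>g. ore_const (ore_const (group_elem g)));
         x = ore_const (ore_var group_algebra);
         y = ore_var (first_ore \<chi>)
     in (\<exists>\<Delta> \<epsilon> S. hopf_algebra H \<Delta> \<epsilon> S \<and>
           (\<forall>g. group_like H \<Delta> (elem g)) \<and>
           skew_primitive H \<Delta> (alg_one H) (elem b) x \<and>
           skew_primitive H \<Delta> (alg_one H) (elem c) y) \<and>
        subalgebra_generated H (range elem \<union> {x, y}) = UNIV \<and>
        (\<forall>g. alg_mult H x (elem g) = alg_scale H (\<chi> g) (alg_mult H (elem g) x)) \<and>
        (\<forall>g. alg_mult H y (elem g) = alg_scale H (\<eta> g) (alg_mult H (elem g) y)) \<and>
        alg_mult H y x =
          alg_scale H (\<eta> b) (alg_mult H x y) + alg_scale H \<beta> (alg_one H - elem (c + b)))"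
proof -
  interpret skew_pair \<chi> \<eta> b c \<beta>
    using assms by unfold_locales
  obtain \<delta> where \<delta>: "skew_derivation (first_ore \<chi>) (winding_first_ore \<chi> b \<eta>) \<delta>"
    "\<And>g. \<delta> (ore_const (group_elem g)) = 0"
    "\<delta> (ore_var group_algebra) = alg_scale (first_ore \<chi>) \<beta>
      (ore_const (group_elem 0) - ore_const (group_elem (c + b)))"
    by (rule skew_derivation_exists) (rule that)
  interpret skew_pair_derivation \<chi> \<eta> b c \<beta> \<delta>
    using \<delta> by unfold_locales
  obtain \<Delta> \<epsilon> S where hopf: "hopf_algebra H \<Delta> \<epsilon> S" "\<And>g. group_like H \<Delta> (E g)"
    "skew_primitive H \<Delta> (alg_one H) (E b) X" "skew_primitive H \<Delta> (alg_one H) (E c) Y"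
    by (rule hopf_structure_exists) (rule that)
  show ?thesis
    unfolding Let_def
    by (intro exI[of _ \<delta>] conjI exI[of _ \<Delta>] exI[of _ \<epsilon>] exI[of _ S] allI
        \<delta>(1) hopf generates_H relations(3-5))
qed

end
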